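(* Let $V$ be a complex vector space of dimension $n$ and let $F\in S^dV$ be a form with an equipotent apolar generator. Then $F$ is a limit of direct sums. Moreover, either $F$ is a direct sum, or there are an integer $k\ge 1$ with $2k\le n$ and a basis $x_1,\dots,x_k,y_1,\dots,y_k,z_1,\dots,z_{n-2k}$ of $V$ such that $$F(x,y,z)=\sum_{i=1}^k x_i\,\frac{\partial H(y)}{\partial y_i}+G(y,z)$$ for some $G\in S^d\langle y_1,\dots,y_k,z_1,\dots,z_{n-2k}\rangle$ and $H\in S^d\langle y_1,\dots,y_k\rangle$.
   Context: Fix a basis $w_1,\dots,w_n$ of $V$, let $S=\mathbb{C}[w_1,\dots,w_n]=\bigoplus_d S^dV$ and let $T=\mathbb{C}[\alpha_1,\dots,\alpha_n]$ be the dual ring, acting on $S$ by letting $\alpha_i$ act as $\partial/\partial w_i$; write $\Theta\circ F$ for this action. The apolar ideal of a nonzero form $F$ is $F^\perp=\{\Theta\in T:\Theta\circ F=0\}$. With $\mathfrak m=\langle\alpha_1,\dots,\alpha_n\rangle$, $F\in S^dV$ has an equipotent apolar generator if $F^\perp$ has a minimal generator of degree $d$, i.e. $(F^\perp/\mathfrak m F^\perp)_d\neq0$. A form $F\in S^dV$ is a direct sum if there are subspaces $V_1,V_2\subset V$ with $V=V_1\oplus V_2$ and nonzero $F_1\in S^dV_1$, $F_2\in S^dV_2$ such that $F=F_1+F_2$. A limit of direct sums is an element of the closure in $S^dV$ of the set of direct sums. *)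

theory Defs
  imports "HOL-Analysis.Analysis" "HOL-Library.Poly_Mapping"
begin

section \<open>Polynomials and forms\<close>

text \<open>
  A monomial is a finitely supported exponent vector; the polynomials in the variables with
  indices \<open>0, ..., n-1\<close> model both \<open>S = \<complex>[w\<^sub>1, ..., w\<^sub>n]\<close> and the dual ring
  \<open>T = \<complex>[\<alpha>\<^sub>1, ..., \<alpha>\<^sub>n]\<close>.  The number of variables is carried as an explicit
  argument because the theorem relates forms in different numbers of variables.
\<close>

type_synonym cpoly = "(nat \<Rightarrow>\<^sub>0 nat) \<Rightarrow>\<^sub>0 complex"

definition Const :: "complex \<Rightarrow> cpoly" where
  "Const c = Poly_Mapping.single 0 c"

definition Var :: "nat \<Rightarrow> cpoly" where
  "Var i = Poly_Mapping.single (Poly_Mapping.single i 1) 1"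

definition mdeg :: "(nat \<Rightarrow>\<^sub>0 nat) \<Rightarrow> nat" where
  "mdeg m = (\<Sum>i\<in>Poly_Mapping.keys m. Poly_Mapping.lookup m i)"

definition polys :: "nat \<Rightarrow> cpoly set" where
  "polys n = {p. \<forall>m\<in>Poly_Mapping.keys p. Poly_Mapping.keys m \<subseteq> {..<n}}"

text \<open>
  \<open>forms n d\<close> is \<open>S\<^sup>dV\<close> (in \<open>S\<close>) or \<open>T\<^sub>d\<close> (in \<open>T\<close>); in particular
  \<open>V = S\<^sup>1V = forms n 1\<close> is the space of linear forms, with basis \<open>Var 0, ..., Var (n-1)\<close>.
\<close>

definition forms :: "nat \<Rightarrow> nat \<Rightarrow> cpoly set" where
  "forms n d = {p \<in> polys n. \<forall>m\<in>Poly_Mapping.keys p. mdeg m = d}"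

definition subst :: "(nat \<Rightarrow> cpoly) \<Rightarrow> cpoly \<Rightarrow> cpoly" where
  "subst b p = (\<Sum>m\<in>Poly_Mapping.keys p. Const (Poly_Mapping.lookup p m) * (\<Prod>i\<in>Poly_Mapping.keys m. b i ^ Poly_Mapping.lookup m i))"

section \<open>Complex linear algebra on polynomials\<close>

definition cscale :: "complex \<Rightarrow> cpoly \<Rightarrow> cpoly" where
  "cscale c p = Const c * p"

interpretation cvec: vector_space cscale
  by unfold_locales
    (simp_all add: cscale_def Const_def algebra_simps single_add mult_single flip: mult.assoc)

text \<open>
  For a space \<open>W\<close> of linear forms, \<open>Sym d W\<close> is \<open>S\<^sup>dW\<close>, regarded as a subspace of \<open>S\<^sup>dV\<close>.
\<close>

definition Sym :: "nat \<Rightarrow> cpoly set \<Rightarrow> cpoly set" where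
  "Sym d W = cvec.span {(\<Prod>j<d. f j) |f. \<forall>j<d. f j \<in> W}"

section \<open>Apolarity\<close>

text \<open>
  Below, \<open>m - Poly_Mapping.single i 1\<close> is truncated subtraction; when \<open>i\<close> does not occur in
  \<open>m\<close> the coefficient vanishes.
\<close>

definition mpderiv :: "nat \<Rightarrow> cpoly \<Rightarrow> cpoly" where
  "mpderiv i p =
     (\<Sum>m\<in>Poly_Mapping.keys p. Poly_Mapping.single (m - Poly_Mapping.single i 1)
                     (of_nat (Poly_Mapping.lookup m i) * Poly_Mapping.lookup p m))"

definition mono_act :: "(nat \<Rightarrow>\<^sub>0 nat) \<Rightarrow> cpoly \<Rightarrow> cpoly" where
  "mono_act a = foldr (\<lambda>i. mpderiv i ^^ Poly_Mapping.lookup a i) (sorted_list_of_set (Poly_Mapping.keys a))"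

definition apolar_act :: "cpoly \<Rightarrow> cpoly \<Rightarrow> cpoly" where
  "apolar_act \<Theta> F = (\<Sum>a\<in>Poly_Mapping.keys \<Theta>. cscale (Poly_Mapping.lookup \<Theta> a) (mono_act a F))"

definition apolar_ideal :: "nat \<Rightarrow> cpoly \<Rightarrow> cpoly set" where
  "apolar_ideal n F = {\<Theta> \<in> polys n. apolar_act \<Theta> F = 0}"

definition irrelevant_ideal :: "nat \<Rightarrow> cpoly set" where
  "irrelevant_ideal n = {(\<Sum>i<n. q i * Var i) |q. \<forall>i<n. q i \<in> polys n}"

definition ideal_product :: "cpoly set \<Rightarrow> cpoly set \<Rightarrow> cpoly set" where
  "ideal_product I J = {(\<Sum>j<r. a j * b j) |(r::nat) a b. \<forall>j<r. a j \<in> I \<and> b j \<in> J}"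

text \<open>
  The degree \<open>d\<close> part of the graded quotient \<open>F\<^sup>\<bottom> / \<mm> F\<^sup>\<bottom>\<close> consists of the classes of the
  elements of \<open>F\<^sup>\<bottom>\<close> that are homogeneous of degree \<open>d\<close>, so it is nonzero iff one of these
  elements lies outside \<open>\<mm> F\<^sup>\<bottom>\<close>.
\<close>

definition has_equipotent_apolar_generator :: "nat \<Rightarrow> nat \<Rightarrow> cpoly \<Rightarrow> bool" where
  "has_equipotent_apolar_generator n d F \<longleftrightarrow>
     (\<exists>\<Theta> \<in> apolar_ideal n F \<inter> forms n d.
        \<Theta> \<notin> ideal_product (irrelevant_ideal n) (apolar_ideal n F))"

section \<open>Direct sums and their limits\<close>

definition is_direct_sum :: "nat \<Rightarrow> nat \<Rightarrow> cpoly \<Rightarrow> bool" where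
  "is_direct_sum n d F \<longleftrightarrow>
     F \<in> forms n d \<and>
     (\<exists>V1 V2 F1 F2.
        cvec.subspace V1 \<and> cvec.subspace V2 \<and>
        V1 \<inter> V2 = {0} \<and> {v1 + v2 |v1 v2. v1 \<in> V1 \<and> v2 \<in> V2} = forms n 1 \<and>
        F1 \<in> Sym d V1 \<and> F1 \<noteq> 0 \<and> F2 \<in> Sym d V2 \<and> F2 \<noteq> 0 \<and>
        F = F1 + F2)"

text \<open>
  The closure is taken in the product topology on coefficient functions.  All forms of
  degree \<open>d\<close> in \<open>n\<close> variables are supported on the same finite set of monomials, so on the
  finite-dimensional space \<open>S\<^sup>dV\<close> this is the usual Euclidean topology.
\<close>

definition is_limit_of_direct_sums :: "nat \<Rightarrow> nat \<Rightarrow> cpoly \<Rightarrow> bool" where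
  "is_limit_of_direct_sums n d F \<longleftrightarrow>
     F \<in> forms n d \<and> Poly_Mapping.lookup F \<in> closure (Poly_Mapping.lookup ` {P. is_direct_sum n d P})"

definition is_basis_of :: "cpoly list \<Rightarrow> cpoly set \<Rightarrow> bool" where
  "is_basis_of bs W \<longleftrightarrow>
     distinct bs \<and> cvec.independent (set bs) \<and> cvec.span (set bs) = W"

end

theory Submission
  imports Defs "HOL-Computational_Algebra.Fundamental_Theorem_Algebra"
begin

text \<open>
  A minimal generator of \<open>F\<^sup>\<bottom>\<close> in degree \<open>d\<close> is, by duality, a form \<open>G\<close> of degree \<open>d\<close> that is not a multiple
  of \<open>F\<close> and whose first partial derivatives are linear combinations of those of \<open>F\<close>
  (lemma \<open>equipotent_companion\<close>).  Choosing such combinations gives a linear operator \<open>B\<close> on \<open>V\<^sup>*\<close> with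
  \<open>B\<alpha>\<circ>F = \<alpha>\<circ>G\<close>.  Since \<open>\<beta>\<alpha>\<circ>G\<close> is symmetric in \<open>\<alpha>\<close> and \<open>\<beta>\<close>, \<open>B\<close> is self-adjoint for the
  form-valued bilinear form \<open>\<alpha>\<beta>\<circ>F\<close>, and so is every polynomial \<open>p(B)\<close>.  Self-adjointness is exactly the
  condition for \<open>p(B)\<alpha>\<circ>F\<close> to be the derivative along \<open>\<alpha>\<close> of a form, the transform of \<open>F\<close> by \<open>p\<close>
  (lemma \<open>dder_transform\<close>).

  Let \<open>I\<close> be the ideal of the \<open>p\<close> whose transform is zero.  The algebra \<open>\<complex>[X]/I\<close> is finite-dimensional, and
  its dimension is at least two because \<open>G\<close> is not a multiple of \<open>F\<close>.  Such an algebra contains a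
  nontrivial idempotent or a nonzero element of square zero
  (lemma \<open>poly_ideal_idempotent_or_nilpotent\<close>).

  An idempotent \<open>u\<close> splits \<open>F\<close> into its transforms by \<open>u\<close> and \<open>1 - u\<close>, whose annihilators in \<open>V\<^sup>*\<close> together
  span \<open>V\<^sup>*\<close>, so \<open>F\<close> is a direct sum (lemma \<open>idempotent_splits\<close>).

  If there is an element of square zero, replace \<open>G\<close> by the corresponding transform.  Then each \<open>\<alpha>\<circ>G\<close> has
  the form \<open>\<beta>\<circ>F\<close> with \<open>\<beta>\<circ>G = 0\<close>.  In suitable coordinates \<open>x, y, z\<close> this makes \<open>G\<close> a polynomial \<open>H(y)\<close> with
  \<open>\<partial>F/\<partial>x\<^sub>i = \<partial>H/\<partial>y\<^sub>i\<close>, which is the asserted normal form: the form \<open>H\<close> of the theorem is \<open>G\<close> itself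
  (lemma \<open>nilpotent_normal_form\<close>).  The sum \<open>\<Sum> x\<^sub>i \<partial>H/\<partial>y\<^sub>i\<close> is the tangent vector \<open>lim (H(y + t x) - H(y)) / t\<close>,
  and for \<open>t \<noteq> 0\<close> the forms in \<open>y + t x\<close> and in \<open>y, z\<close> are in direct sum; hence \<open>F\<close> is a limit of direct
  sums (lemma \<open>limit_of_direct_sums\<close>).
\<close>

section \<open>Polynomials, substitution and derivatives\<close>

abbreviation lookup :: "('a \<Rightarrow>\<^sub>0 'b::zero) \<Rightarrow> 'a \<Rightarrow> 'b" where
  "lookup \<equiv> Poly_Mapping.lookup"

abbreviation keys :: "('a \<Rightarrow>\<^sub>0 'b::zero) \<Rightarrow> 'a set" where
  "keys \<equiv> Poly_Mapping.keys"

abbreviation single :: "'a \<Rightarrow> 'b \<Rightarrow> ('a \<Rightarrow>\<^sub>0 'b::zero)" where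
  "single \<equiv> Poly_Mapping.single"

lemma poly_mapping_decomp: "p = (\<Sum>m\<in>keys p. single m (lookup p m))"
  by (rule poly_mapping_eqI) (simp add: lookup_sum lookup_single when_def in_keys_iff)

lemma poly_mapping_sum_induct [case_names single add]:
  fixes p :: "'a \<Rightarrow>\<^sub>0 'b::comm_monoid_add"
  assumes "\<And>m c. P (single m c)" and "\<And>p q. P p \<Longrightarrow> P q \<Longrightarrow> P (p + q)"
  shows "P p"
proof -
  have "P (\<Sum>m\<in>A. single m (lookup p m))" if "finite A" for A
    using that
  proof (induction A)
    case empty
    show ?case using assms(1)[of undefined 0] by simp
  qed (simp add: assms)
  from this[of "keys p"] show ?thesis by (simp flip: poly_mapping_decomp)
qed

lemma Const_0 [simp]: "Const 0 = 0" and Const_1 [simp]: "Const 1 = 1"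
  and Const_add: "Const (a + b) = Const a + Const b"
  and Const_mult: "Const (a * b) = Const a * Const b"
  by (simp_all add: Const_def single_add mult_single)

lemma Const_eq_0: "Const c = 0 \<longleftrightarrow> c = 0"
  by (auto simp: Const_def dest: arg_cong[of _ _ "\<lambda>p. lookup p 0"])

lemma Const_times_single: "Const c * single m a = single m (c * a)"
  by (simp add: Const_def mult_single)

lemma lookup_Const_mult [simp]: "lookup (Const c * p) m = c * lookup p m"
  by (induction p rule: poly_mapping_sum_induct)
    (simp_all add: Const_times_single lookup_single when_def distrib_left lookup_add)

lemma lookup_cscale [simp]: "lookup (cscale c p) m = c * lookup p m"
  by (simp add: cscale_def)

lemma keys_cscale: "keys (cscale c p) \<subseteq> keys p"
  by (auto simp: in_keys_iff)

subsection \<open>Substitution is a ring homomorphism\<close>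

definition mono_eval :: "(nat \<Rightarrow> cpoly) \<Rightarrow> (nat \<Rightarrow>\<^sub>0 nat) \<Rightarrow> cpoly" where
  "mono_eval b m = (\<Prod>i\<in>keys m. b i ^ lookup m i)"

lemma mono_eval_superset:
  "finite A \<Longrightarrow> keys m \<subseteq> A \<Longrightarrow> mono_eval b m = (\<Prod>i\<in>A. b i ^ lookup m i)"
  unfolding mono_eval_def by (rule prod.mono_neutral_left) (auto simp: in_keys_iff)

lemma mono_eval_0 [simp]: "mono_eval b 0 = 1"
  by (simp add: mono_eval_def)

lemma mono_eval_add: "mono_eval b (m + m') = mono_eval b m * mono_eval b m'"
proof -
  have "keys (m + m') \<subseteq> keys m \<union> keys m'" by (rule keys_add)
  then show ?thesis
    by (simp add: mono_eval_superset[where A = "keys m \<union> keys m'"] lookup_add power_add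
        prod.distrib)
qed

lemma mono_eval_single: "mono_eval b (single i k) = b i ^ k"
  by (simp add: mono_eval_def)

lemma subst_alt: "subst b p = (\<Sum>m\<in>keys p. Const (lookup p m) * mono_eval b m)"
  by (simp add: subst_def mono_eval_def)

lemma subst_single: "subst b (single m c) = Const c * mono_eval b m"
  by (simp add: subst_alt)

lemma subst_add: "subst b (p + q) = subst b p + subst b q"
  unfolding subst_alt
  by (rule setsum_keys_plus_distrib) (simp_all add: Const_add algebra_simps)

lemma subst_mult: "subst b (p * q) = subst b p * subst b q"
proof (induction p rule: poly_mapping_sum_induct)
  case (single m c)
  show ?case
    by (induction q rule: poly_mapping_sum_induct)
      (simp_all add: mult_single subst_single mono_eval_add Const_mult algebra_simps subst_add)
qed (simp add: subst_add algebra_simps)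

lemma subst_Const [simp]: "subst b (Const c) = Const c"
  by (simp add: Const_def subst_single)

lemma subst_Var [simp]: "subst b (Var i) = b i"
  by (simp add: Var_def subst_single mono_eval_single)

lemma subst_0 [simp]: "subst b 0 = 0" and subst_1 [simp]: "subst b 1 = 1"
  using subst_Const[of b 0] subst_Const[of b 1] by simp_all

lemma subst_diff: "subst b (p - q) = subst b p - subst b q"
  using subst_add[of b "p - q" q] by simp

lemma subst_cscale: "subst b (cscale c p) = cscale c (subst b p)"
  by (simp add: cscale_def subst_mult)

lemma subst_sum: "subst b (\<Sum>x\<in>A. f x) = (\<Sum>x\<in>A. subst b (f x))"
  by (induction A rule: infinite_finite_induct) (simp_all add: subst_add)

lemma subst_prod: "subst b (\<Prod>x\<in>A. f x) = (\<Prod>x\<in>A. subst b (f x))"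
  by (induction A rule: infinite_finite_induct) (simp_all add: subst_mult)

lemma subst_power: "subst b (p ^ k) = subst b p ^ k"
  by (induction k) (simp_all add: subst_mult)

lemma mono_eval_Var: "mono_eval Var m = single m 1"
proof -
  have pw: "Var i ^ k = single (single i k) 1" for i k
    by (induction k) (simp_all add: Var_def mult_single flip: single_add)
  have "(\<Prod>i\<in>A. Var i ^ lookup m i) = single (\<Sum>i\<in>A. single i (lookup m i)) 1" if "finite A" for A
    using that by (induction A) (simp_all add: pw mult_single)
  then show ?thesis
    by (simp add: mono_eval_def flip: poly_mapping_decomp)
qed

lemma subst_Var_id: "subst Var p = p"
  unfolding subst_alt mono_eval_Var
  by (simp add: Const_times_single flip: poly_mapping_decomp)

lemma subst_subst: "subst a (subst b p) = subst (\<lambda>i. subst a (b i)) p"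
proof (induction p rule: poly_mapping_sum_induct)
  case (single m c)
  show ?case by (simp add: subst_single subst_mult mono_eval_def subst_prod subst_power)
qed (simp add: subst_add)

lemma subst_cong:
  assumes "p \<in> polys n" and "\<And>i. i < n \<Longrightarrow> a i = b i"
  shows "subst a p = subst b p"
proof -
  have "mono_eval a m = mono_eval b m" if m: "m \<in> keys p" for m
  proof -
    have "i < n" if "i \<in> keys m" for i using assms(1) m that by (auto simp: polys_def)
    then show ?thesis unfolding mono_eval_def by (intro prod.cong) (auto simp: assms(2))
  qed
  then show ?thesis by (simp add: subst_alt)
qed

subsection \<open>The graded pieces\<close>

lemma polys_0 [simp]: "0 \<in> polys n" and polys_Const [simp]: "Const c \<in> polys n"
  by (auto simp: polys_def Const_def)

lemma polys_1 [simp]: "1 \<in> polys n"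
  using polys_Const[of 1 n] by simp

lemma polys_Var: "i < n \<Longrightarrow> Var i \<in> polys n"
  by (simp add: polys_def Var_def)

lemma polysI: "(\<And>m. m \<in> keys p \<Longrightarrow> keys m \<subseteq> {..<n}) \<Longrightarrow> p \<in> polys n"
  by (simp add: polys_def)

lemma polysD: "p \<in> polys n \<Longrightarrow> m \<in> keys p \<Longrightarrow> keys m \<subseteq> {..<n}"
  by (simp add: polys_def)

lemma polys_add: "p \<in> polys n \<Longrightarrow> q \<in> polys n \<Longrightarrow> p + q \<in> polys n"
  using keys_add[of p q] by (intro polysI) (auto dest: polysD)

lemma polys_mult: "p \<in> polys n \<Longrightarrow> q \<in> polys n \<Longrightarrow> p * q \<in> polys n"
proof (rule polysI)
  fix m assume pq: "p \<in> polys n" "q \<in> polys n" and "m \<in> keys (p * q)"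
  then obtain a b where "a \<in> keys p" "b \<in> keys q" and m: "m = a + b"
    using keys_mult[of p q] by auto
  then have "keys a \<union> keys b \<subseteq> {..<n}" using pq polysD by blast
  then show "keys m \<subseteq> {..<n}" using keys_add[of a b] m by auto
qed

lemma polys_cscale: "p \<in> polys n \<Longrightarrow> cscale c p \<in> polys n"
  by (simp add: cscale_def polys_mult)

text \<open>Membership in \<^const>\<open>polys\<close> means being generated by constants and variables, so ring
  homomorphisms and derivations can be compared on generators.\<close>

lemma polys_induct [consumes 1, case_names Const Var add mult]:
  assumes "p \<in> polys n" and "\<And>c. P (Const c)" and "\<And>i. i < n \<Longrightarrow> P (Var i)"
    and "\<And>p q. p \<in> polys n \<Longrightarrow> q \<in> polys n \<Longrightarrow> P p \<Longrightarrow> P q \<Longrightarrow> P (p + q)"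
    and "\<And>p q. p \<in> polys n \<Longrightarrow> q \<in> polys n \<Longrightarrow> P p \<Longrightarrow> P q \<Longrightarrow> P (p * q)"
  shows "P p"
proof -
  let ?Q = "\<lambda>p. p \<in> polys n \<and> P p"
  have c: "?Q (Const c)" for c by (simp add: assms)
  have pow: "?Q (Var i ^ k)" if "i < n" for i k
    by (induction k) (use that c[of 1] in \<open>auto simp: polys_Var polys_mult assms\<close>)
  have pr: "?Q (\<Prod>i\<in>A. Var i ^ lookup m i)" if "A \<subseteq> {..<n}" "finite A" for A m
    using that(2,1) by (induction A) (use c[of 1] pow in \<open>auto simp: polys_mult assms\<close>)
  have "?Q (\<Sum>m\<in>A. Const (lookup p m) * mono_eval Var m)" if "A \<subseteq> keys p" "finite A" for A
    using that(2,1)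
  proof (induction A)
    case empty
    show ?case using c[of 0] by simp
  next
    case (insert m A)
    then have "keys m \<subseteq> {..<n}" using assms(1) by (auto simp: polys_def)
    then have "?Q (mono_eval Var m)" unfolding mono_eval_def by (intro pr) auto
    then have "?Q (Const (lookup p m) * mono_eval Var m)"
      using c by (auto intro!: polys_mult assms)
    then show ?case using insert by (auto intro!: polys_add assms)
  qed
  from this[of "keys p"] show ?thesis by (simp add: subst_Var_id flip: subst_alt)
qed

lemma mdeg_superset: "finite A \<Longrightarrow> keys m \<subseteq> A \<Longrightarrow> mdeg m = (\<Sum>i\<in>A. lookup m i)"
  unfolding mdeg_def by (rule sum.mono_neutral_left) (auto simp: in_keys_iff)

lemma mdeg_add: "mdeg (m + m') = mdeg m + mdeg m'"
proof -
  have "keys (m + m') \<subseteq> keys m \<union> keys m'" by (rule keys_add)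
  then show ?thesis
    by (simp add: mdeg_superset[where A = "keys m \<union> keys m'"] lookup_add sum.distrib)
qed

lemma mdeg_single [simp]: "mdeg (single i k) = k"
  by (simp add: mdeg_def)

lemma mdeg_0 [simp]: "mdeg 0 = 0"
  by (simp add: mdeg_def)

lemma mdeg_eq_0: "mdeg m = 0 \<longleftrightarrow> m = 0"
proof
  assume "mdeg m = 0"
  then have "lookup m i = 0" for i by (cases "i \<in> keys m") (auto simp: mdeg_def in_keys_iff)
  then show "m = 0" by (intro poly_mapping_eqI) simp
qed simp

lemma monomial_split:
  fixes m :: "nat \<Rightarrow>\<^sub>0 nat"
  assumes "lookup m i \<noteq> 0"
  obtains m' where "m = m' + single i 1" "keys m' \<subseteq> keys m"
proof
  show "m = (m - single i 1) + single i 1"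
    using assms by (intro poly_mapping_eqI) (auto simp: lookup_add lookup_minus lookup_single when_def)
  show "keys (m - single i 1) \<subseteq> keys m"
    by (auto simp: in_keys_iff lookup_minus)
qed

lemma mdeg_Suc:
  assumes "mdeg m = Suc d"
  obtains i m' where "m = m' + single i 1" "mdeg m' = d" "i \<in> keys m" "keys m' \<subseteq> keys m"
proof -
  from assms obtain i where i: "i \<in> keys m" by (auto simp: mdeg_def dest!: sum_SucD)
  then have "lookup m i \<noteq> 0" by (simp add: in_keys_iff)
  then obtain m' where m': "m = m' + single i 1" "keys m' \<subseteq> keys m" by (rule monomial_split)
  then have "mdeg m' = d" using assms by (simp add: mdeg_add)
  with m' i that show thesis by blast
qed

lemma finite_monomials: "finite {m. keys m \<subseteq> {..<n} \<and> mdeg m = d}"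
proof (induction d)
  case 0
  have "{m. keys m \<subseteq> {..<n} \<and> mdeg m = 0} \<subseteq> {0}" by (auto simp: mdeg_eq_0)
  then show ?case by (rule finite_subset) simp
next
  case (Suc d)
  have "{m. keys m \<subseteq> {..<n} \<and> mdeg m = Suc d} \<subseteq>
      (\<lambda>(m, i). m + single i 1) ` ({m. keys m \<subseteq> {..<n} \<and> mdeg m = d} \<times> {..<n})"
  proof
    fix m :: "nat \<Rightarrow>\<^sub>0 nat"
    assume "m \<in> {m. keys m \<subseteq> {..<n} \<and> mdeg m = Suc d}"
    then have m: "keys m \<subseteq> {..<n}" "mdeg m = Suc d" by auto
    obtain i m' where "m = m' + single i 1" "mdeg m' = d" "i \<in> keys m" "keys m' \<subseteq> keys m"
      using m(2) by (rule mdeg_Suc)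
    with m show "m \<in> (\<lambda>(m, i). m + single i 1) ` ({m. keys m \<subseteq> {..<n} \<and> mdeg m = d} \<times> {..<n})"
      by (intro image_eqI[where x = "(m', i)"]) auto
  qed
  then show ?case by (rule finite_subset) (use Suc in simp)
qed

lemma forms_iff: "p \<in> forms n d \<longleftrightarrow> (\<forall>m. lookup p m \<noteq> 0 \<longrightarrow> keys m \<subseteq> {..<n} \<and> mdeg m = d)"
  by (auto simp: forms_def polys_def in_keys_iff)

lemma forms_0 [simp]: "0 \<in> forms n d"
  by (simp add: forms_iff)

lemma formsI: "p \<in> polys n \<Longrightarrow> (\<And>m. m \<in> keys p \<Longrightarrow> mdeg m = d) \<Longrightarrow> p \<in> forms n d"
  by (simp add: forms_def)

lemma forms_polys: "p \<in> forms n d \<Longrightarrow> p \<in> polys n"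
  by (simp add: forms_def)

lemma forms_mdeg: "p \<in> forms n d \<Longrightarrow> m \<in> keys p \<Longrightarrow> mdeg m = d"
  by (simp add: forms_def)

lemma forms_add: "p \<in> forms n d \<Longrightarrow> q \<in> forms n d \<Longrightarrow> p + q \<in> forms n d"
  using keys_add[of p q] by (intro formsI polys_add) (auto dest: forms_polys forms_mdeg)

lemma forms_cscale: "p \<in> forms n d \<Longrightarrow> cscale c p \<in> forms n d"
  by (simp add: forms_iff)

lemma subspace_forms: "cvec.subspace (forms n d)"
  by (simp add: cvec.subspace_def forms_add forms_cscale)

lemmas forms_diff = cvec.subspace_diff[OF subspace_forms]
lemmas forms_sum = cvec.subspace_sum[OF subspace_forms]

lemma forms_mult:
  assumes "p \<in> forms n d" "q \<in> forms n e"
  shows "p * q \<in> forms n (d + e)"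
proof (rule formsI)
  show "p * q \<in> polys n" using assms by (intro polys_mult forms_polys)
  fix m assume "m \<in> keys (p * q)"
  then obtain a b where "a \<in> keys p" "b \<in> keys q" "m = a + b"
    using keys_mult[of p q] by auto
  then show "mdeg m = d + e" using assms by (simp add: mdeg_add forms_mdeg)
qed

lemma forms_single: "keys m \<subseteq> {..<n} \<Longrightarrow> mdeg m = d \<Longrightarrow> single m c \<in> forms n d"
  by (simp add: forms_iff lookup_single when_def)

lemma forms_Var: "i < n \<Longrightarrow> Var i \<in> forms n 1"
  by (simp add: Var_def forms_single)

lemma forms_Const: "Const c \<in> forms n 0"
  by (simp add: Const_def forms_single)

lemma mono_eval_forms:
  "(\<And>i. i < k \<Longrightarrow> b i \<in> forms n 1) \<Longrightarrow> keys m \<subseteq> {..<k} \<Longrightarrow> mono_eval b m \<in> forms n (mdeg m)"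
proof (induction "mdeg m" arbitrary: m)
  case 0
  then show ?case using forms_Const[of 1 n] by (simp add: mdeg_eq_0)
next
  case (Suc d)
  from Suc.hyps(2)[symmetric] obtain i m'
    where m: "m = m' + single i 1" "mdeg m' = d" "i \<in> keys m" "keys m' \<subseteq> keys m"
    by (rule mdeg_Suc)
  have "mono_eval b m' \<in> forms n (mdeg m')"
    using Suc m by (intro Suc.hyps(1)) auto
  moreover have "b i \<in> forms n 1" using Suc.prems m by auto
  ultimately show ?case
    by (auto simp: m(1) mono_eval_add mono_eval_single mdeg_add dest: forms_mult)
qed

lemma subst_forms:
  assumes "\<And>i. i < k \<Longrightarrow> b i \<in> forms n 1" and "p \<in> forms k d"
  shows "subst b p \<in> forms n d"
  unfolding subst_alt
proof (rule forms_sum)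
  fix m assume "m \<in> keys p"
  then have "keys m \<subseteq> {..<k}" "mdeg m = d" using assms(2) by (auto simp: forms_def polys_def)
  then show "Const (lookup p m) * mono_eval b m \<in> forms n d"
    using mono_eval_forms[OF assms(1), where m = m] forms_cscale by (auto simp flip: cscale_def)
qed

text \<open>The products of linear forms that span \<^const>\<open>Sym\<close> include all monomials in linear forms
  of \<open>W\<close>.\<close>

lemma subst_Sym:
  assumes "p \<in> forms k d" and "\<And>m i. m \<in> keys p \<Longrightarrow> i \<in> keys m \<Longrightarrow> b i \<in> W"
  shows "subst b p \<in> Sym d W"
proof -
  have prod: "\<exists>f. (\<forall>j<mdeg m. f j \<in> W) \<and> mono_eval b m = (\<Prod>j<mdeg m. f j)"
    if "\<And>i. i \<in> keys m \<Longrightarrow> b i \<in> W" for m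
    using that
  proof (induction "mdeg m" arbitrary: m)
    case 0
    then show ?case by (simp add: mdeg_eq_0)
  next
    case (Suc d)
    from Suc.hyps(2)[symmetric] obtain i m'
      where m: "m = m' + single i 1" "mdeg m' = d" "i \<in> keys m" "keys m' \<subseteq> keys m"
      by (rule mdeg_Suc)
    then obtain f where f: "\<forall>j<d. f j \<in> W" "mono_eval b m' = (\<Prod>j<d. f j)"
      using Suc.hyps(1)[of m'] Suc.prems by blast
    show ?case
      using f Suc.prems m
      by (intro exI[of _ "f(d := b i)"])
        (auto simp: mdeg_add mono_eval_add mono_eval_single less_Suc_eq simp flip: Suc.hyps(2))
  qed
  show ?thesis
    unfolding subst_alt Sym_def
  proof (intro cvec.span_sum)
    fix m assume m: "m \<in> keys p"
    then have "mdeg m = d" using assms(1) by (simp add: forms_def)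
    then obtain f where "\<forall>j<d. f j \<in> W" "mono_eval b m = (\<Prod>j<d. f j)"
      using prod[of m] assms(2) m by blast
    then have "mono_eval b m \<in> cvec.span {\<Prod>j<d. f j |f. \<forall>j<d. f j \<in> W}"
      by (intro cvec.span_base) auto
    from cvec.span_scale[OF this]
    show "Const (lookup p m) * mono_eval b m \<in> cvec.span {\<Prod>j<d. f j |f. \<forall>j<d. f j \<in> W}"
      by (simp add: cscale_def)
  qed
qed

subsection \<open>Partial derivatives\<close>

lemma lookup_mpderiv:
  "lookup (mpderiv i p) m = of_nat (lookup m i + 1) * lookup p (m + single i 1)"
proof -
  have eq: "of_nat (lookup a i) * lookup p a = 0"
    if "a - single i 1 = m" "a \<noteq> m + single i 1" for a
  proof (cases "lookup a i = 0")
    case False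
    then obtain a' where "a = a' + single i 1" by (rule monomial_split)
    with that show ?thesis by simp
  qed simp
  have "lookup (mpderiv i p) m =
      (\<Sum>a\<in>keys p. (of_nat (lookup a i) * lookup p a when a - single i 1 = m))"
    by (simp add: mpderiv_def lookup_sum lookup_single)
  also have "\<dots> = (\<Sum>a\<in>keys p. (of_nat (lookup a i) * lookup p a when a = m + single i 1))"
    by (intro sum.cong) (auto simp: when_def eq)
  also have "\<dots> = of_nat (lookup m i + 1) * lookup p (m + single i 1)"
    by (auto simp: when_def in_keys_iff lookup_add)
  finally show ?thesis .
qed

lemma mpderiv_add: "mpderiv i (p + q) = mpderiv i p + mpderiv i q"
  by (rule poly_mapping_eqI) (simp add: lookup_mpderiv lookup_add distrib_left del: of_nat_Suc)

lemma mpderiv_cscale: "mpderiv i (cscale c p) = cscale c (mpderiv i p)"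
  by (rule poly_mapping_eqI) (simp add: lookup_mpderiv)

lemma mpderiv_0 [simp]: "mpderiv i 0 = 0"
  by (rule poly_mapping_eqI) (simp add: lookup_mpderiv)

lemma mpderiv_commute: "mpderiv i (mpderiv j p) = mpderiv j (mpderiv i p)"
  by (rule poly_mapping_eqI)
    (cases "i = j"; simp add: lookup_mpderiv lookup_add lookup_single algebra_simps)

lemma mpderiv_single: "mpderiv i (single m c) = single (m - single i 1) (of_nat (lookup m i) * c)"
  by (simp add: mpderiv_def)

lemma mpderiv_mult: "mpderiv i (p * q) = mpderiv i p * q + p * mpderiv i q"
proof -
  have minus: "(if lookup a i = 0 then 0 else single (a - single i 1 + b) c) =
      (if lookup a i = 0 then 0 else single (a + b - single i 1) c)" for a b :: "nat \<Rightarrow>\<^sub>0 nat" and c :: complex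
  proof (cases "lookup a i = 0")
    case False
    then obtain a' where a: "a = a' + single i 1" by (rule monomial_split)
    have "a - single i 1 + b = a' + b" by (simp add: a)
    moreover have "a + b = a' + b + single i 1" by (simp add: a ac_simps)
    then have "a + b - single i 1 = a' + b" by simp
    ultimately show ?thesis by (simp only: )
  qed simp
  have ss: "mpderiv i (single a c * single b e) =
      mpderiv i (single a c) * single b e + single a c * mpderiv i (single b e)" for a b c e
    using minus[of a b "of_nat (lookup a i) * c * e"] minus[of b a "of_nat (lookup b i) * c * e"]
    by (cases "lookup a i = 0"; cases "lookup b i = 0")
      (simp_all add: mult_single mpderiv_single lookup_add algebra_simps single_add)
  show ?thesis
  proof (induction p rule: poly_mapping_sum_induct)
    case (single m c)
    show ?case
      by (induction q rule: poly_mapping_sum_induct)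
        (simp_all only: ss distrib_left mpderiv_add, simp add: algebra_simps)
  qed (simp add: algebra_simps mpderiv_add)
qed

lemma mpderiv_Const [simp]: "mpderiv i (Const c) = 0"
  by (simp add: Const_def mpderiv_single)

lemma mpderiv_Var: "mpderiv i (Var j) = (if i = j then 1 else 0)"
  by (simp add: Var_def mpderiv_single lookup_single when_def)

lemma keys_mpderiv: "m \<in> keys (mpderiv i p) \<Longrightarrow> m + single i 1 \<in> keys p"
  by (auto simp: in_keys_iff lookup_mpderiv)

lemma mpderiv_polys:
  assumes "p \<in> polys n"
  shows "mpderiv i p \<in> polys n"
proof (rule polysI)
  fix m assume "m \<in> keys (mpderiv i p)"
  then have "keys (m + single i 1) \<subseteq> {..<n}" using assms by (intro polysD keys_mpderiv)
  moreover have "keys m \<subseteq> keys (m + single i 1)" by (auto simp: in_keys_iff lookup_add)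
  ultimately show "keys m \<subseteq> {..<n}" by blast
qed

lemma mpderiv_forms:
  assumes "p \<in> forms n d"
  shows "mpderiv i p \<in> forms n (d - 1)"
proof (rule formsI)
  show "mpderiv i p \<in> polys n" using assms by (intro mpderiv_polys forms_polys)
  fix m assume "m \<in> keys (mpderiv i p)"
  then have "mdeg (m + single i 1) = d" using assms by (intro forms_mdeg keys_mpderiv)
  then show "mdeg m = d - 1" by (simp add: mdeg_add)
qed

lemma mpderiv_eq_0_iff: "mpderiv i p = 0 \<longleftrightarrow> (\<forall>m\<in>keys p. i \<notin> keys m)"
proof
  assume z: "mpderiv i p = 0"
  show "\<forall>m\<in>keys p. i \<notin> keys m"
  proof (intro ballI notI)
    fix m assume m: "m \<in> keys p" "i \<in> keys m"
    then have "lookup m i \<noteq> 0" by (simp add: in_keys_iff)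
    then obtain m' where "m = m' + single i 1" by (rule monomial_split)
    with arg_cong[OF z, of "\<lambda>q. lookup q m'"] m show False
      by (simp add: lookup_mpderiv in_keys_iff del: of_nat_Suc)
  qed
next
  assume "\<forall>m\<in>keys p. i \<notin> keys m"
  then show "mpderiv i p = 0"
    by (auto simp: mpderiv_def in_keys_iff intro!: sum.neutral)
qed

text \<open>Euler's identity, which reconstructs a form from its gradient.\<close>

lemma euler:
  assumes "p \<in> forms n d"
  shows "(\<Sum>i<n. Var i * mpderiv i p) = cscale (of_nat d) p"
proof -
  have mono: "(\<Sum>i<n. Var i * mpderiv i (single m c)) = single m (of_nat d * c)"
    if "keys m \<subseteq> {..<n}" "mdeg m = d" for m c
  proof -
    have "Var i * mpderiv i (single m c) = single m (of_nat (lookup m i) * c)" for i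
    proof (cases "lookup m i = 0")
      case False
      then obtain m' where "m = m' + single i 1" by (rule monomial_split)
      then show ?thesis by (simp add: Var_def mpderiv_single mult_single add.commute)
    qed (simp add: mpderiv_single)
    moreover have "(\<Sum>i\<in>A. single m (of_nat (lookup m i) * c)) = single m (of_nat (\<Sum>i\<in>A. lookup m i) * c)"
      if "finite A" for A
      using that by (induction A) (simp_all add: distrib_right single_add)
    ultimately show ?thesis
      using that mdeg_superset[of "{..<n}" m] by (simp flip: of_nat_sum)
  qed
  have "(\<Sum>i<n. Var i * mpderiv i (\<Sum>m\<in>A. single m (lookup p m))) =
      cscale (of_nat d) (\<Sum>m\<in>A. single m (lookup p m))" if "A \<subseteq> keys p" "finite A" for A
    using that(2,1)
  proof (induction A)
    case (insert m A)
    then have "keys m \<subseteq> {..<n}" "mdeg m = d" using assms by (auto simp: forms_def polys_def)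
    with insert mono[of m "lookup p m"] show ?case
      by (simp add: mpderiv_add distrib_left sum.distrib cscale_def Const_times_single)
  qed simp
  from this[of "keys p"] show ?thesis by (simp flip: poly_mapping_decomp)
qed

section \<open>Linear algebra on the space of linear forms\<close>

subsection \<open>Directional derivatives\<close>

text \<open>An element \<open>\<alpha>\<close> of the dual space \<open>V\<^sup>*\<close> is encoded by the linear form with the same coordinates,
  and \<open>dder n \<alpha>\<close> is its action on polynomials.  In this encoding the vector space structure on
  polynomials serves \<open>V\<close> and \<open>V\<^sup>*\<close> alike.\<close>

definition dder :: "nat \<Rightarrow> cpoly \<Rightarrow> cpoly \<Rightarrow> cpoly" where
  "dder n \<alpha> P = (\<Sum>i<n. cscale (lookup \<alpha> (single i 1)) (mpderiv i P))"

lemma cscale_1: "cscale c 1 = Const c"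
  by (simp add: cscale_def)

lemma dder_add_left: "dder n (\<alpha> + \<beta>) P = dder n \<alpha> P + dder n \<beta> P"
  by (simp add: dder_def lookup_add cvec.scale_left_distrib sum.distrib)

lemma dder_cscale_left: "dder n (cscale c \<alpha>) P = cscale c (dder n \<alpha> P)"
  by (simp add: dder_def cvec.scale_sum_right)

lemma dder_0_left [simp]: "dder n 0 P = 0"
  by (simp add: dder_def)

lemma dder_sum_left: "dder n (\<Sum>x\<in>A. f x) P = (\<Sum>x\<in>A. dder n (f x) P)"
  by (induction A rule: infinite_finite_induct) (simp_all add: dder_add_left)

lemma dder_add: "dder n \<alpha> (P + Q) = dder n \<alpha> P + dder n \<alpha> Q"
  by (simp add: dder_def mpderiv_add cvec.scale_right_distrib sum.distrib)

lemma dder_cscale: "dder n \<alpha> (cscale c P) = cscale c (dder n \<alpha> P)"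
  by (simp add: dder_def mpderiv_cscale cvec.scale_sum_right ac_simps)

lemma dder_0 [simp]: "dder n \<alpha> 0 = 0"
  by (simp add: dder_def)

lemma dder_sum: "dder n \<alpha> (\<Sum>x\<in>A. f x) = (\<Sum>x\<in>A. dder n \<alpha> (f x))"
  by (induction A rule: infinite_finite_induct) (simp_all add: dder_add)

lemma dder_diff: "dder n \<alpha> (P - Q) = dder n \<alpha> P - dder n \<alpha> Q"
  using dder_add[of n \<alpha> "P - Q" Q] by simp

lemma dder_diff_left: "dder n (\<alpha> - \<beta>) P = dder n \<alpha> P - dder n \<beta> P"
  using dder_add_left[of n "\<alpha> - \<beta>" \<beta> P] by simp

lemma dder_mult: "dder n \<alpha> (P * Q) = dder n \<alpha> P * Q + P * dder n \<alpha> Q"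
  by (simp add: dder_def mpderiv_mult cscale_def sum_distrib_left sum_distrib_right sum.distrib
      algebra_simps)

lemma dder_Const [simp]: "dder n \<alpha> (Const c) = 0"
  by (simp add: dder_def)

lemma lookup_Var [simp]: "lookup (Var i) (single j (Suc 0)) = (if i = j then 1 else 0)"
proof -
  have "single i (Suc 0) = single j (Suc 0) \<longleftrightarrow> i = j"
    by (metis keys_single One_nat_def one_neq_zero singleton_inject)
  then show ?thesis by (simp add: Var_def lookup_single when_def)
qed

lemma dder_Var_left: "i < n \<Longrightarrow> dder n (Var i) P = mpderiv i P"
  by (simp add: dder_def if_distrib[of "\<lambda>c. cscale c _"] cong: if_cong)

lemma mpderiv_sum: "mpderiv i (\<Sum>x\<in>A. f x) = (\<Sum>x\<in>A. mpderiv i (f x))"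
  by (induction A rule: infinite_finite_induct) (simp_all add: mpderiv_add)

lemma mpderiv_dder: "mpderiv i (dder n \<alpha> P) = dder n \<alpha> (mpderiv i P)"
  by (simp add: dder_def mpderiv_sum mpderiv_cscale mpderiv_commute[of i])

lemma dder_commute: "dder n \<alpha> (dder n \<beta> P) = dder n \<beta> (dder n \<alpha> P)"
  by (simp add: dder_def[of n \<alpha>] mpderiv_dder dder_sum dder_cscale)

lemma dder_forms: "P \<in> forms n d \<Longrightarrow> dder n \<alpha> P \<in> forms n (d - 1)"
  unfolding dder_def by (intro forms_sum forms_cscale mpderiv_forms)

lemma chain_rule:
  "p \<in> polys k \<Longrightarrow> dder n \<alpha> (subst b p) = (\<Sum>i<k. dder n \<alpha> (b i) * subst b (mpderiv i p))"
proof (induction rule: polys_induct)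
  case (Var j)
  then show ?case by (simp add: mpderiv_Var if_distrib cong: if_cong)
qed (simp_all add: subst_add subst_mult dder_add dder_mult mpderiv_add mpderiv_mult
    sum.distrib sum_distrib_left sum_distrib_right algebra_simps)

lemma forms_degree_0: "p \<in> forms n 0 \<Longrightarrow> p = Const (lookup p 0)"
  by (rule poly_mapping_eqI)
    (auto simp: forms_iff Const_def lookup_single when_def mdeg_eq_0)

lemma linear_form_expand:
  assumes "\<alpha> \<in> forms n 1"
  shows "\<alpha> = (\<Sum>i<n. cscale (lookup \<alpha> (single i 1)) (Var i))"
proof -
  have "mpderiv i \<alpha> = Const (lookup \<alpha> (single i 1))" for i
    using forms_degree_0[OF mpderiv_forms[OF assms, simplified], of i] by (simp add: lookup_mpderiv)
  with euler[OF assms] show ?thesis by (simp add: cscale_def ac_simps)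
qed

lemma gradient_eq_0:
  assumes "P \<in> forms n d" and "d \<ge> 1" and "\<And>i. i < n \<Longrightarrow> mpderiv i P = 0"
  shows "P = 0"
  using euler[OF assms(1)] assms(2,3) by simp

lemma dder_eq_0:
  assumes "P \<in> forms n d" and "d \<ge> 1" and "\<And>\<alpha>. \<alpha> \<in> forms n 1 \<Longrightarrow> dder n \<alpha> P = 0"
  shows "P = 0"
proof (rule gradient_eq_0[OF assms(1,2)])
  fix i assume "i < n"
  with assms(3)[OF forms_Var] show "mpderiv i P = 0" by (simp add: dder_Var_left)
qed

subsection \<open>Finite bases and dual bases\<close>

lemma span_image_lessThan:
  assumes "inj_on e {..<n::nat}" and "v \<in> cvec.span (e ` {..<n})"
  obtains c where "v = (\<Sum>j<n. cscale (c j) (e j))"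
proof -
  from assms(2) obtain u where "v = (\<Sum>x\<in>e ` {..<n}. cscale (u x) x)"
    by (auto simp: cvec.span_finite)
  with that[of "u \<circ> e"] assms(1) show thesis by (simp add: sum.reindex)
qed

lemma independent_image_lessThan:
  assumes "inj_on e {..<n::nat}" and "cvec.independent (e ` {..<n})"
    and "(\<Sum>j<n. cscale (c j) (e j)) = (\<Sum>j<n. cscale (c' j) (e j))" and "i < n"
  shows "c i = c' i"
proof -
  let ?u = "\<lambda>x. c (the_inv_into {..<n} e x) - c' (the_inv_into {..<n} e x)"
  have "(\<Sum>x\<in>e ` {..<n}. cscale (?u x) x) = (\<Sum>j<n. cscale (c j - c' j) (e j))"
    using assms(1) by (simp add: sum.reindex the_inv_into_f_f)
  also have "\<dots> = 0"
    using assms(3) by (simp add: cvec.scale_left_diff_distrib sum_subtractf)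
  finally have "?u (e i) = 0"
    using cvec.independentD[OF assms(2), of "e ` {..<n}" ?u "e i"] assms(4) by simp
  then show ?thesis using assms(1,4) by (simp add: the_inv_into_f_f)
qed

lemma independent_image_lessThanI:
  assumes "\<And>c. (\<Sum>j<n. cscale (c j) (e j)) = 0 \<Longrightarrow> \<forall>j<n. c j = 0"
  shows "inj_on e {..<n::nat}" and "cvec.independent (e ` {..<n})"
proof -
  show inj: "inj_on e {..<n}"
  proof (rule inj_onI, rule ccontr)
    fix i j assume ij: "i \<in> {..<n}" "j \<in> {..<n}" "e i = e j" "i \<noteq> j"
    let ?c = "\<lambda>k. if k = i then 1 else if k = j then - 1 else 0 :: complex"
    have "(\<Sum>k<n. cscale (?c k) (e k)) =
        (\<Sum>k<n. (if k = i then e i else 0) + (if k = j then - e j else 0))"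
      using ij by (intro sum.cong) auto
    also have "\<dots> = 0" using ij by (simp add: sum.distrib)
    finally show False using assms[of ?c] ij by auto
  qed
  show "cvec.independent (e ` {..<n})"
  proof
    assume "cvec.dependent (e ` {..<n})"
    then obtain u v where "v \<in> e ` {..<n}" "u v \<noteq> 0" "(\<Sum>x\<in>e ` {..<n}. cscale (u x) x) = 0"
      by (auto simp: cvec.dependent_finite)
    with assms[of "u \<circ> e"] inj show False by (auto simp: sum.reindex)
  qed
qed

lemma Var_basis:
  shows "inj_on Var {..<n}" and "cvec.independent (Var ` {..<n})"
    and "cvec.span (Var ` {..<n}) = forms n 1"
proof -
  have "c k = 0" if "(\<Sum>j<n. cscale (c j) (Var j)) = 0" "k < n" for c k
    using arg_cong[OF that(1), of "\<lambda>p. lookup p (single k 1)"] that(2)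
    by (simp add: lookup_sum if_distrib cong: if_cong)
  then have *: "\<And>c. (\<Sum>j<n. cscale (c j) (Var j)) = 0 \<Longrightarrow> \<forall>j<n. c j = 0" by blast
  show "inj_on Var {..<n}" by (rule independent_image_lessThanI(1)[OF *])
  show "cvec.independent (Var ` {..<n})" by (rule independent_image_lessThanI(2)[OF *])
  show "cvec.span (Var ` {..<n}) = forms n 1"
  proof
    show "cvec.span (Var ` {..<n}) \<subseteq> forms n 1"
      by (rule cvec.span_minimal) (auto simp del: One_nat_def intro: forms_Var subspace_forms)
    show "forms n 1 \<subseteq> cvec.span (Var ` {..<n})"
    proof
      fix \<alpha> assume "\<alpha> \<in> forms n 1"
      then have "\<alpha> = (\<Sum>i<n. cscale (lookup \<alpha> (single i 1)) (Var i))" by (rule linear_form_expand)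
      also have "\<dots> \<in> cvec.span (Var ` {..<n})"
        by (intro cvec.span_sum cvec.span_scale cvec.span_base) auto
      finally show "\<alpha> \<in> cvec.span (Var ` {..<n})" .
    qed
  qed
qed

lemma card_basis_forms:
  assumes "cvec.independent B" and "cvec.span B = forms n 1"
  shows "finite B" and "card B = n"
proof -
  have V: "card (Var ` {..<n}) = n" using card_image[OF Var_basis(1)] by simp
  have B: "B \<subseteq> cvec.span (Var ` {..<n})" using cvec.span_superset[of B] assms Var_basis(3) by simp
  from cvec.independent_span_bound[OF _ assms(1) B] have le: "card B \<le> n" and fin: "finite B"
    using V by auto
  then show "finite B" by simp
  have "Var ` {..<n} \<subseteq> cvec.span B"
    unfolding assms(2) using cvec.span_superset[of "Var ` {..<n}"] Var_basis(3) by simp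
  from cvec.independent_span_bound[OF fin Var_basis(2) this] V le
  show "card B = n" by simp
qed

lemma kronecker_sum: "i < n \<Longrightarrow> (\<Sum>j<n. cscale (if i = j then 1 else 0) (f j)) = f (i::nat)"
  by (simp add: if_distrib[of "\<lambda>c. cscale c _"] cong: if_cong)

text \<open>Here \<open>e\<close> is a basis of \<open>V\<^sup>*\<close> and \<open>l\<close> the dual basis of \<open>V\<close>.  The last assumption says that the \<open>l j\<close>
  are coordinates: a form annihilated by some of the \<open>e i\<close> is a form in the remaining \<open>l j\<close>.\<close>

locale dual_bases =
  fixes n :: nat and e l :: "nat \<Rightarrow> cpoly"
  assumes e_form: "i < n \<Longrightarrow> e i \<in> forms n 1" and l_form: "j < n \<Longrightarrow> l j \<in> forms n 1"
    and dual: "i < n \<Longrightarrow> j < n \<Longrightarrow> dder n (e i) (l j) = (if i = j then 1 else 0)"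
    and adapted: "P \<in> forms n d \<Longrightarrow> (\<And>i. i \<in> I \<Longrightarrow> i < n) \<Longrightarrow>
      (\<And>i. i \<in> I \<Longrightarrow> dder n (e i) P = 0) \<Longrightarrow>
      \<exists>f\<in>forms n d. P = subst l f \<and> (\<forall>m\<in>keys f. keys m \<inter> I = {})"
begin

lemma dder_subst: "i < n \<Longrightarrow> p \<in> polys n \<Longrightarrow> dder n (e i) (subst l p) = subst l (mpderiv i p)"
  by (simp add: chain_rule dual if_distrib[of "\<lambda>c. c * _"] cong: if_cong)

lemma dder_combination:
  "i < n \<Longrightarrow> dder n (e i) (\<Sum>j<n. cscale (c j) (l j)) = Const (c i)"
  by (simp add: dder_sum dder_cscale dual if_distrib[of "cscale _"] cscale_1 cong: if_cong)

lemma combination: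
  assumes "v \<in> forms n 1"
  obtains c where "v = (\<Sum>j<n. cscale (c j) (l j))"
proof -
  from adapted[OF assms, of "{}"] obtain f where f: "f \<in> forms n 1" "v = subst l f" by auto
  have "v = subst l (\<Sum>i<n. cscale (lookup f (single i 1)) (Var i))"
    using f linear_form_expand[OF f(1)] by simp
  with that show thesis by (simp add: subst_sum subst_cscale)
qed

lemma basis:
  shows "inj_on l {..<n}" and "cvec.independent (l ` {..<n})"
    and "cvec.span (l ` {..<n}) = forms n 1"
proof -
  have "c i = 0" if "(\<Sum>j<n. cscale (c j) (l j)) = 0" "i < n" for c i
    using dder_combination[OF that(2), of c] that(1) by (simp add: Const_eq_0)
  then have *: "\<And>c. (\<Sum>j<n. cscale (c j) (l j)) = 0 \<Longrightarrow> \<forall>j<n. c j = 0" by blast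
  show "inj_on l {..<n}" by (rule independent_image_lessThanI(1)[OF *])
  show "cvec.independent (l ` {..<n})" by (rule independent_image_lessThanI(2)[OF *])
  show "cvec.span (l ` {..<n}) = forms n 1"
  proof
    show "cvec.span (l ` {..<n}) \<subseteq> forms n 1"
      by (rule cvec.span_minimal) (auto simp del: One_nat_def intro: l_form subspace_forms)
    show "forms n 1 \<subseteq> cvec.span (l ` {..<n})"
    proof
      fix v assume "v \<in> forms n 1"
      then obtain c where "v = (\<Sum>j<n. cscale (c j) (l j))" by (rule combination)
      then show "v \<in> cvec.span (l ` {..<n})"
        by (simp only:) (intro cvec.span_sum cvec.span_scale cvec.span_base imageI)
    qed
  qed
qed

lemma dder_span_eq_0:
  assumes "v \<in> cvec.span S" and "\<And>s. s \<in> S \<Longrightarrow> dder n \<alpha> s = 0"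
  shows "dder n \<alpha> v = 0"
  using assms(1)
  by (induction rule: cvec.span_induct_alt) (auto simp: assms(2) dder_add dder_cscale)

lemma eq_0_if_dder_eq_0:
  assumes "v \<in> forms n 1" and "\<And>i. i < n \<Longrightarrow> dder n (e i) v = 0"
  shows "v = 0"
proof -
  from assms(1) obtain c where v: "v = (\<Sum>j<n. cscale (c j) (l j))" by (rule combination)
  have "c i = 0" if "i < n" for i
    using dder_combination[OF that, of c] assms(2)[OF that] by (simp add: v Const_eq_0)
  then show ?thesis by (simp add: v)
qed

end

text \<open>With \<open>A\<close> the coordinate matrix of \<open>e\<close> and \<open>M\<close> its inverse, the columns of \<open>M\<close> are the dual basis \<open>l\<close>.
  Rewriting a form in the coordinates \<open>l\<close> is the substitution \<open>w\<close> by the columns of \<open>A\<close>, which is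
  inverse to the substitution by \<open>l\<close>; by the chain rule it turns \<open>e i\<close> into the partial derivative
  with respect to the \<open>i\<close>-th variable, whose vanishing means that this variable is absent.\<close>

lemma dual_bases_exist:
  assumes inj: "inj_on e {..<n}" and ind: "cvec.independent (e ` {..<n})"
    and span: "cvec.span (e ` {..<n}) = forms n 1"
  obtains l where "dual_bases n e l"
proof -
  have ef: "e i \<in> forms n 1" if "i < n" for i
    using cvec.span_base[of "e i" "e ` {..<n}"] that span by auto
  have "\<exists>c. Var i = (\<Sum>j<n. cscale (c j) (e j))" if "i < n" for i
    using span_image_lessThan[OF inj, of "Var i"] forms_Var[OF that] span by metis
  then obtain M where M: "\<And>i. i < n \<Longrightarrow> Var i = (\<Sum>j<n. cscale (M i j) (e j))" by metis
  define A where "A i k = lookup (e i) (single k 1)" for i k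
  \<comment> \<open>One product of the two matrices is read off coefficientwise, the other uses the independence of \<open>e\<close>.\<close>
  have MA: "(\<Sum>j<n. M i j * A j k) = (if i = k then 1 else 0)" if "i < n" for i k
    using arg_cong[OF M[OF that], of "\<lambda>p. lookup p (single k 1)"]
    by (simp add: lookup_sum A_def)
  have AM: "(\<Sum>k<n. A i k * M k j) = (if i = j then 1 else 0)" if "i < n" "j < n" for i j
  proof (rule independent_image_lessThan[OF inj ind _ that(2)])
    have "(\<Sum>j<n. cscale (if i = j then 1 else 0) (e j)) = e i" by (rule kronecker_sum[OF that(1)])
    also have "e i = (\<Sum>k<n. cscale (A i k) (Var k))"
      unfolding A_def using ef[OF that(1)] by (rule linear_form_expand)
    also have "\<dots> = (\<Sum>k<n. \<Sum>j<n. cscale (A i k * M k j) (e j))"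
      by (simp add: M cvec.scale_sum_right)
    also have "\<dots> = (\<Sum>j<n. cscale (\<Sum>k<n. A i k * M k j) (e j))"
      by (subst sum.swap) (simp add: cvec.scale_sum_left)
    finally show "(\<Sum>j<n. cscale (\<Sum>k<n. A i k * M k j) (e j)) =
        (\<Sum>j<n. cscale (if i = j then 1 else 0) (e j))" by simp
  qed
  define l where "l j = (\<Sum>i<n. cscale (M i j) (Var i))" for j
  define w where "w k = (\<Sum>j<n. cscale (A j k) (Var j))" for k
  have lf: "l j \<in> forms n 1" and wf: "w j \<in> forms n 1" for j
    unfolding l_def w_def by (auto simp del: One_nat_def intro!: forms_sum forms_cscale forms_Var)
  have dual: "dder n (e i) (l j) = (if i = j then 1 else 0)" if ij: "i < n" "j < n" for i j
  proof -
    have "mpderiv k (l j) = Const (M k j)" if "k < n" for k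
      using that by (simp add: l_def mpderiv_sum mpderiv_cscale mpderiv_Var if_distrib[of "cscale _"] cscale_1 cong: if_cong)
    then have "dder n (e i) (l j) = (\<Sum>k<n. Const (A i k * M k j))"
      by (simp add: dder_def A_def cscale_def Const_mult)
    also have "\<dots> = Const (\<Sum>k<n. A i k * M k j)"
      by (induction n) (simp_all add: Const_add)
    finally show ?thesis by (simp add: AM[OF ij])
  qed
  have lw: "subst l (w k) = Var k" if "k < n" for k
  proof -
    have "subst l (w k) = (\<Sum>j<n. \<Sum>i<n. cscale (M i j * A j k) (Var i))"
      by (simp add: w_def subst_sum subst_cscale l_def cvec.scale_sum_right mult.commute)
    also have "\<dots> = (\<Sum>i<n. cscale (\<Sum>j<n. M i j * A j k) (Var i))"
      by (subst sum.swap) (simp add: cvec.scale_sum_left)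
    also have "\<dots> = Var k"
      using kronecker_sum[OF that, of Var] by (simp add: MA eq_commute)
    finally show ?thesis .
  qed
  have wl: "subst w (l j) = Var j" if "j < n" for j
  proof -
    have "subst w (l j) = (\<Sum>i<n. \<Sum>k<n. cscale (A k i * M i j) (Var k))"
      by (simp add: w_def subst_sum subst_cscale l_def cvec.scale_sum_right mult.commute)
    also have "\<dots> = (\<Sum>k<n. cscale (\<Sum>i<n. A k i * M i j) (Var k))"
      by (subst sum.swap) (simp add: cvec.scale_sum_left)
    also have "\<dots> = Var j"
      using kronecker_sum[OF that, of Var] that by (simp add: AM eq_commute)
    finally show ?thesis .
  qed
  have "dual_bases n e l"
  proof
    fix P d I
    assume P: "P \<in> forms n d" and I: "\<And>i. i \<in> I \<Longrightarrow> i < n"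
      and zero: "\<And>i. i \<in> I \<Longrightarrow> dder n (e i) P = 0"
    define f where "f = subst w P"
    have f: "f \<in> forms n d" unfolding f_def by (rule subst_forms[OF wf P])
    have Pf: "P = subst l f"
      unfolding f_def subst_subst using subst_cong[OF forms_polys[OF P], of _ Var] lw
      by (simp add: subst_Var_id)
    have "mpderiv i f = 0" if i: "i \<in> I" for i
    proof -
      have "dder n (e i) (subst l f) = (\<Sum>k<n. (if i = k then 1 else 0) * subst l (mpderiv k f))"
        using I[OF i] by (simp add: chain_rule[OF forms_polys[OF f]] dual)
      also have "\<dots> = subst l (mpderiv i f)"
        using I[OF i] by (simp add: if_distrib[of "\<lambda>c. c * _"] cong: if_cong)
      finally have "subst w (subst l (mpderiv i f)) = 0" using zero[OF i] Pf by simp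
      then show ?thesis
        using subst_cong[OF mpderiv_polys[OF forms_polys[OF f]], of _ Var i] wl
        by (simp add: subst_subst subst_Var_id)
    qed
    then have "\<forall>m\<in>keys f. keys m \<inter> I = {}" by (auto simp: mpderiv_eq_0_iff)
    with f Pf show "\<exists>f\<in>forms n d. P = subst l f \<and> (\<forall>m\<in>keys f. keys m \<inter> I = {})" by blast
  qed (simp_all add: ef lf dual del: One_nat_def)
  then show thesis by (rule that)
qed

section \<open>From an equipotent generator to a companion form\<close>

subsection \<open>The apolar pairing\<close>

text \<open>Letting a monomial of \<open>T\<close> act on the same monomial of \<open>S\<close> gives the constant \<open>m! = \<Prod> m\<^sub>i!\<close>, the weight of
  \<open>m\<close> in the pairing between \<open>T\<^sub>d\<close> and \<open>S\<^sup>dV\<close>.\<close>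

definition mfact :: "(nat \<Rightarrow>\<^sub>0 nat) \<Rightarrow> complex" where
  "mfact m = (\<Prod>i\<in>keys m. fact (lookup m i))"

lemma mfact_neq_0 [simp]: "mfact m \<noteq> 0"
  by (simp add: mfact_def)

lemma mfact_superset: "finite A \<Longrightarrow> keys m \<subseteq> A \<Longrightarrow> mfact m = (\<Prod>i\<in>A. fact (lookup m i))"
  unfolding mfact_def by (rule prod.mono_neutral_left) (auto simp: in_keys_iff)

lemma mfact_add_single: "mfact (m + single i 1) = mfact m * of_nat (lookup m i + 1)"
proof -
  have *: "mfact m' = fact (lookup m' i) * (\<Prod>j\<in>keys m - {i}. fact (lookup m' j))"
    if "keys m' \<subseteq> insert i (keys m)" for m'
    using that by (simp add: mfact_superset[OF _ that] prod.insert_remove)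
  have "(\<Prod>j\<in>keys m - {i}. fact (lookup (m + single i 1) j) :: complex) =
      (\<Prod>j\<in>keys m - {i}. fact (lookup m j))"
    by (intro prod.cong) (auto simp: lookup_add lookup_single when_def)
  with *[of m, OF subset_insertI] *[of "m + single i 1"] keys_add[of m "single i 1"] show ?thesis
    by (auto simp: lookup_add algebra_simps)
qed

lemma lookup_mpderiv_funpow:
  "lookup ((mpderiv i ^^ k) p) m =
    pochhammer (of_nat (lookup m i + 1)) k * lookup p (m + single i k)"
proof (induction k arbitrary: m)
  case (Suc k)
  have "single i 1 + single i k = single i (Suc k)" by (simp flip: single_add)
  then have "m + single i 1 + single i k = m + single i (Suc k)" by (simp add: add.assoc)
  moreover have "(of_nat (lookup m i + 1) + 1 :: complex) = of_nat (lookup (m + single i 1) i + 1)"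
    by (simp add: lookup_add)
  ultimately show ?case
    by (simp only: funpow.simps comp_apply lookup_mpderiv Suc pochhammer_rec mult.assoc)
qed simp

lemma lookup_mono_act:
  "lookup (mono_act a p) m =
    (\<Prod>i\<in>keys a. pochhammer (of_nat (lookup m i + 1)) (lookup a i)) * lookup p (m + a)"
proof -
  have "lookup (foldr (\<lambda>i. mpderiv i ^^ lookup a i) xs p) m =
      (\<Prod>i\<in>set xs. pochhammer (of_nat (lookup m i + 1)) (lookup a i)) *
      lookup p (m + (\<Sum>i\<in>set xs. single i (lookup a i)))" if "distinct xs" for xs
    using that
  proof (induction xs arbitrary: m)
    case (Cons j xs)
    then have "lookup (m + single j (lookup a j)) i = lookup m i" if "i \<in> set xs" for i
      using that by (auto simp: lookup_add lookup_single when_def)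
    with Cons show ?case
      by (simp add: lookup_mpderiv_funpow mult.assoc add.assoc del: of_nat_Suc of_nat_add
          cong: prod.cong)
  qed simp
  from this[of "sorted_list_of_set (keys a)"] show ?thesis
    by (simp add: mono_act_def flip: poly_mapping_decomp del: of_nat_Suc of_nat_add)
qed

lemma lookup_mono_act_0: "lookup (mono_act a p) 0 = mfact a * lookup p a"
  by (simp add: lookup_mono_act mfact_def pochhammer_fact)

lemma mpderiv_mono_act: "mpderiv j (mono_act a p) = mono_act a (mpderiv j p)"
proof -
  have pow: "mpderiv j ((mpderiv i ^^ k) p) = (mpderiv i ^^ k) (mpderiv j p)" for i k p
    by (induction k) (simp_all add: mpderiv_commute[of j])
  have "mpderiv j (foldr (\<lambda>i. mpderiv i ^^ lookup a i) xs p) =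
      foldr (\<lambda>i. mpderiv i ^^ lookup a i) xs (mpderiv j p)" for xs
    by (induction xs) (simp_all add: pow)
  then show ?thesis by (simp add: mono_act_def)
qed

definition pairing :: "cpoly \<Rightarrow> cpoly \<Rightarrow> complex" where
  "pairing \<Theta> P = lookup (apolar_act \<Theta> P) 0"

lemma pairing_alt: "pairing \<Theta> P = (\<Sum>m\<in>keys \<Theta>. lookup \<Theta> m * (mfact m * lookup P m))"
  by (simp add: pairing_def apolar_act_def lookup_sum lookup_mono_act_0)

lemma pairing_commute: "pairing \<Theta> P = pairing P \<Theta>"
proof -
  have "pairing \<Theta> P = (\<Sum>m\<in>keys \<Theta> \<union> keys P. lookup \<Theta> m * (mfact m * lookup P m))" for \<Theta> P
    unfolding pairing_alt by (rule sum.mono_neutral_left) (auto simp: in_keys_iff)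
  from this[of \<Theta> P] this[of P \<Theta>] show ?thesis by (simp add: Un_commute mult_ac)
qed

text \<open>Multiplication by \<open>\<alpha>\<^sub>i\<close> on \<open>T\<close> is adjoint to \<open>\<partial>/\<partial>w\<^sub>i\<close> on \<open>S\<close>.\<close>

lemma pairing_Var_mult: "pairing (Var i * \<Theta>) P = pairing \<Theta> (mpderiv i P)"
proof -
  have add: "pairing (\<Theta> + \<Theta>') P = pairing \<Theta> P + pairing \<Theta>' P" for \<Theta> \<Theta>' P
    unfolding pairing_alt by (rule setsum_keys_plus_distrib) (auto simp: algebra_simps)
  show ?thesis
  proof (induction \<Theta> rule: poly_mapping_sum_induct)
    case (single m c)
    have "Var i * single m c = single (m + single i 1) c"
      by (simp add: Var_def mult_single add.commute)
    then show ?case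
      by (simp add: pairing_alt lookup_mpderiv mfact_add_single[simplified] algebra_simps)
  qed (simp add: add distrib_left)
qed

subsection \<open>Linear functionals on forms\<close>

text \<open>Every linear functional on forms of degree \<open>d\<close> is pairing with a form: the factorials
  in the pairing are invertible in characteristic zero.\<close>

lemma functional_represented:
  fixes f :: "cpoly \<Rightarrow> complex"
  assumes add: "\<And>p q. f (p + q) = f p + f q" and scale: "\<And>c p. f (cscale c p) = c * f p"
  obtains G where "G \<in> forms n d" and "\<And>\<Theta>. \<Theta> \<in> forms n d \<Longrightarrow> pairing \<Theta> G = f \<Theta>"
proof
  define M where "M = {m. keys m \<subseteq> {..<n} \<and> mdeg m = d}"
  have finM: "finite M" unfolding M_def by (rule finite_monomials)
  define G where "G = (\<Sum>m\<in>M. single m (f (single m 1) / mfact m))"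
  have G: "lookup G m = f (single m 1) / mfact m" if "m \<in> M" for m
    using finM that by (simp add: G_def lookup_sum lookup_single when_def)
  show "G \<in> forms n d"
    unfolding G_def by (intro forms_sum forms_single) (auto simp: M_def)
  have f0: "f 0 = 0" using scale[of 0 0] by simp
  have fsum: "f (\<Sum>x\<in>A. g x) = (\<Sum>x\<in>A. f (g x))" if "finite A" for A and g :: "(nat \<Rightarrow>\<^sub>0 nat) \<Rightarrow> cpoly"
    using that by (induction A) (simp_all add: f0 add)
  have fsingle: "c * f (single m 1) = f (single m c)" for m c
    using scale[of c "single m 1"] by (simp add: cscale_def Const_times_single)
  fix \<Theta> assume \<Theta>: "\<Theta> \<in> forms n d"
  then have sub: "m \<in> M" if "m \<in> keys \<Theta>" for m
    using that polysD[OF forms_polys[OF \<Theta>]] forms_mdeg by (auto simp: M_def)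
  have "pairing \<Theta> G = (\<Sum>m\<in>keys \<Theta>. lookup \<Theta> m * f (single m 1))"
    unfolding pairing_alt by (intro sum.cong refl) (simp add: G sub)
  also have "\<dots> = f (\<Sum>m\<in>keys \<Theta>. single m (lookup \<Theta> m))"
    by (simp add: fsum fsingle)
  also have "\<dots> = f \<Theta>" by (simp flip: poly_mapping_decomp)
  finally show "pairing \<Theta> G = f \<Theta>" .
qed

lemma separating_functional:
  assumes "cvec.subspace U" and "x \<notin> U"
  obtains f :: "cpoly \<Rightarrow> complex" where "\<And>p q. f (p + q) = f p + f q"
    and "\<And>c p. f (cscale c p) = c * f p" and "\<And>u. u \<in> U \<Longrightarrow> f u = 0" and "f x = 1"
proof -
  interpret vp: vector_space_pair cscale "(*) :: complex \<Rightarrow> complex \<Rightarrow> complex"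
    by unfold_locales (auto simp: algebra_simps)
  from cvec.maximal_independent_subset[of U] obtain B
    where B: "B \<subseteq> U" "cvec.independent B" "U \<subseteq> cvec.span B" by blast
  have "cvec.span B \<subseteq> U" using B(1) assms(1) by (rule cvec.span_minimal)
  then have "cvec.independent (insert x B)"
    using B assms(2) by (intro cvec.independent_insertI) auto
  from vp.linear_independent_extend[OF this, of "\<lambda>b. if b = x then 1 else 0"]
  obtain f where lin: "Vector_Spaces.linear cscale (*) f"
    and f: "\<forall>b\<in>insert x B. f b = (if b = x then 1 else 0 :: complex)" by blast
  have 1: "f (p + q) = f p + f q" and 2: "f (cscale c p) = c * f p" for p q c
    using lin by (simp_all add: vp.linear_add vp.linear_scale)
  have "f u = 0" if "u \<in> cvec.span B" for u
    using that
  proof (induction rule: cvec.span_induct_alt)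
    case base
    show ?case using 2[of 0 0] by simp
  next
    case (step c b y)
    then show ?case using f B(1) assms(2) by (auto simp: 1 2)
  qed
  with that[OF 1 2] f B(3) show thesis by auto
qed

text \<open>An operator of degree \<open>d - 1\<close> takes \<open>F\<close> to a linear form, and the coefficients of this linear form
  are the pairings with the partial derivatives of \<open>F\<close>.\<close>

lemma apolar_act_eq_0:
  assumes \<Theta>: "\<Theta> \<in> forms n (d - 1)" and F: "F \<in> forms n d" and d: "d \<ge> 1"
    and zero: "\<And>j. j < n \<Longrightarrow> pairing \<Theta> (mpderiv j F) = 0"
  shows "apolar_act \<Theta> F = 0"
proof (rule poly_mapping_eqI)
  fix m
  have lk: "lookup (apolar_act \<Theta> F) m = (\<Sum>a\<in>keys \<Theta>. lookup \<Theta> a * lookup (mono_act a F) m)"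
    by (simp add: apolar_act_def lookup_sum)
  show "lookup (apolar_act \<Theta> F) m = lookup 0 m"
  proof (cases "\<exists>a\<in>keys \<Theta>. lookup (mono_act a F) m \<noteq> 0")
    case True
    then obtain a where a: "a \<in> keys \<Theta>" "m + a \<in> keys F"
      by (auto simp: lookup_mono_act in_keys_iff)
    have "mdeg (m + a) = d" "mdeg a = d - 1"
      using forms_mdeg[OF F a(2)] forms_mdeg[OF \<Theta> a(1)] by auto
    then have "mdeg m = Suc 0" using d by (simp add: mdeg_add)
    then obtain j m' where m: "m = m' + single j 1" "mdeg m' = 0" "j \<in> keys m" by (rule mdeg_Suc)
    then have mj: "m = single j 1" by (simp add: mdeg_eq_0)
    have "keys m \<subseteq> keys (m + a)" by (auto simp: in_keys_iff lookup_add)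
    then have "j < n" using polysD[OF forms_polys[OF F] a(2)] m(3) by auto
    have "lookup (mono_act a F) m = mfact a * lookup (mpderiv j F) a" for a
      using lookup_mpderiv[of j "mono_act a F" 0] lookup_mono_act_0[of a "mpderiv j F"]
      by (simp add: mj mpderiv_mono_act)
    then have "lookup (apolar_act \<Theta> F) m = pairing \<Theta> (mpderiv j F)"
      unfolding lk pairing_alt by (simp only:)
    then show ?thesis using zero[OF \<open>j < n\<close>] by simp
  next
    case False
    then show ?thesis unfolding lk lookup_zero by (intro sum.neutral) auto
  qed
qed

subsection \<open>The companion form\<close>

lemma subspace_ideal_product:
  assumes "cvec.subspace J"
  shows "cvec.subspace (ideal_product I J)"
proof (rule cvec.subspaceI)
  show "0 \<in> ideal_product I J"
    unfolding ideal_product_def by (auto intro!: exI[of _ 0])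
next
  fix x y assume "x \<in> ideal_product I J" "y \<in> ideal_product I J"
  then obtain r s :: nat and a b a' b' where
    x: "x = (\<Sum>j<r. a j * b j)" "\<forall>j<r. a j \<in> I \<and> b j \<in> J" and
    y: "y = (\<Sum>j<s. a' j * b' j)" "\<forall>j<s. a' j \<in> I \<and> b' j \<in> J"
    unfolding ideal_product_def by blast
  define A where "A j = (if j < r then a j else a' (j - r))" for j
  define B where "B j = (if j < r then b j else b' (j - r))" for j
  have "(\<Sum>j<r + k. A j * B j) = x + (\<Sum>j<k. a' j * b' j)" for k
    by (induction k) (auto simp: A_def B_def x(1) add.assoc)
  then have "x + y = (\<Sum>j<r + s. A j * B j)" by (simp add: y(1))
  moreover have "\<forall>j<r + s. A j \<in> I \<and> B j \<in> J" using x(2) y(2) by (auto simp: A_def B_def)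
  ultimately show "x + y \<in> ideal_product I J" unfolding ideal_product_def by blast
next
  fix c x assume "x \<in> ideal_product I J"
  then obtain r :: nat and a b where x: "x = (\<Sum>j<r. a j * b j)" "\<forall>j<r. a j \<in> I \<and> b j \<in> J"
    unfolding ideal_product_def by blast
  have "cscale c x = (\<Sum>j<r. a j * cscale c (b j))"
    by (simp add: x(1) cscale_def sum_distrib_left mult_ac)
  moreover have "\<forall>j<r. a j \<in> I \<and> cscale c (b j) \<in> J"
    using x(2) assms by (simp add: cvec.subspace_scale)
  ultimately show "cscale c x \<in> ideal_product I J"
    unfolding ideal_product_def by (intro CollectI exI[of _ r] exI[of _ a] exI[of _ "\<lambda>j. cscale c (b j)"]) simp
qed

lemma apolar_act_alt: "apolar_act \<Theta> F = (\<Sum>a\<in>keys \<Theta>. Const (lookup \<Theta> a) * mono_act a F)"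
  by (simp add: apolar_act_def cscale_def)

lemma subspace_apolar_ideal: "cvec.subspace (apolar_ideal n F)"
proof (rule cvec.subspaceI)
  show "0 \<in> apolar_ideal n F" by (simp add: apolar_ideal_def apolar_act_def)
next
  fix x y assume "x \<in> apolar_ideal n F" "y \<in> apolar_ideal n F"
  moreover have "apolar_act (x + y) F = apolar_act x F + apolar_act y F"
    unfolding apolar_act_alt by (rule setsum_keys_plus_distrib) (simp_all add: Const_add algebra_simps)
  ultimately show "x + y \<in> apolar_ideal n F" by (simp add: apolar_ideal_def polys_add)
next
  fix c x assume x: "x \<in> apolar_ideal n F"
  have "apolar_act (cscale c x) F = (\<Sum>a\<in>keys x. Const (lookup (cscale c x) a) * mono_act a F)"
    unfolding apolar_act_alt by (rule sum.mono_neutral_left) (auto simp: in_keys_iff)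
  also have "\<dots> = cscale c (apolar_act x F)"
    by (simp add: apolar_act_alt cvec.scale_sum_right) (simp add: cscale_def Const_mult mult.assoc)
  finally show "cscale c x \<in> apolar_ideal n F" using x by (simp add: apolar_ideal_def polys_cscale)
qed

lemma Var_mult_in_ideal_product:
  assumes "i < n" and "\<Theta> \<in> J"
  shows "Var i * \<Theta> \<in> ideal_product (irrelevant_ideal n) J"
proof -
  have "Var i = (\<Sum>j<n. (if j = i then 1 else 0) * Var j)"
    using assms(1) by (simp add: if_distrib[of "\<lambda>c. c * _"] cong: if_cong)
  then have "Var i \<in> irrelevant_ideal n"
    unfolding irrelevant_ideal_def by (intro CollectI exI[of _ "\<lambda>j. if j = i then 1 else 0"]) auto
  with assms(2) show ?thesis
    unfolding ideal_product_def
    by (intro CollectI exI[of _ "1::nat"] exI[of _ "\<lambda>_. Var i"] exI[of _ "\<lambda>_. \<Theta>"]) simp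
qed

text \<open>An element of degree \<open>d\<close> of \<open>F\<^sup>\<bottom>\<close> outside \<open>\<mm> F\<^sup>\<bottom>\<close> is detected by a linear functional that vanishes on
  \<open>\<mm> F\<^sup>\<bottom>\<close>, and this functional is pairing with a form \<open>G\<close>.  As the pairing with \<open>F\<close> vanishes on all of
  \<open>F\<^sup>\<bottom>\<close>, \<open>G\<close> is not a multiple of \<open>F\<close>.  On the other hand each operator \<open>\<Theta>\<close> of degree \<open>d - 1\<close> in \<open>F\<^sup>\<bottom>\<close>
  is orthogonal to every \<open>\<partial>G/\<partial>w\<^sub>i\<close>, because \<open>\<alpha>\<^sub>i \<Theta>\<close> lies in \<open>\<mm> F\<^sup>\<bottom>\<close>.  These \<open>\<Theta>\<close> are the operators
  orthogonal to the partial derivatives of \<open>F\<close>, so by duality in degree \<open>d - 1\<close> the partial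
  derivatives of \<open>G\<close> are linear combinations of those of \<open>F\<close>.\<close>

lemma equipotent_companion:
  assumes F: "F \<in> forms n d" "F \<noteq> 0" and gen: "has_equipotent_apolar_generator n d F"
  obtains G where "d \<ge> 1" and "G \<in> forms n d" and "\<And>c. G \<noteq> cscale c F"
    and "\<And>\<alpha>. \<alpha> \<in> forms n 1 \<Longrightarrow> \<exists>\<beta>\<in>forms n 1. dder n \<alpha> G = dder n \<beta> F"
proof -
  let ?U = "ideal_product (irrelevant_ideal n) (apolar_ideal n F)"
  have U: "cvec.subspace ?U" by (intro subspace_ideal_product subspace_apolar_ideal)
  from gen obtain \<Theta>\<^sub>0 where \<Theta>0: "apolar_act \<Theta>\<^sub>0 F = 0" "\<Theta>\<^sub>0 \<in> forms n d" "\<Theta>\<^sub>0 \<notin> ?U"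
    by (auto simp: has_equipotent_apolar_generator_def apolar_ideal_def)
  have p0: "pairing \<Theta>\<^sub>0 F = 0" by (simp add: pairing_def \<Theta>0)
  have d: "d \<ge> 1"
  proof (rule ccontr)
    assume "\<not> d \<ge> 1"
    then obtain s t where st: "F = Const s" "\<Theta>\<^sub>0 = Const t"
      using forms_degree_0 F(1) \<Theta>0(2) by (metis less_one linorder_not_le)
    have "\<Theta>\<^sub>0 \<noteq> 0" using \<Theta>0(3) cvec.subspace_0[OF U] by metis
    then have "pairing \<Theta>\<^sub>0 F = t * s"
      by (auto simp: pairing_alt st Const_def mfact_def)
    moreover have "s \<noteq> 0" "t \<noteq> 0" using F(2) \<open>\<Theta>\<^sub>0 \<noteq> 0\<close> st by auto
    ultimately show False using p0 by simp
  qed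
  obtain f :: "cpoly \<Rightarrow> complex" where f: "\<And>p q. f (p + q) = f p + f q"
    "\<And>c p. f (cscale c p) = c * f p" "\<And>u. u \<in> ?U \<Longrightarrow> f u = 0" "f \<Theta>\<^sub>0 = 1"
    by (rule separating_functional[OF U \<Theta>0(3)]) blast
  obtain G where G: "G \<in> forms n d" "\<And>\<Theta>. \<Theta> \<in> forms n d \<Longrightarrow> pairing \<Theta> G = f \<Theta>"
    by (rule functional_represented[of f n d]) (use f(1,2) in auto)
  have notmult: "G \<noteq> cscale c F" for c
  proof
    assume "G = cscale c F"
    then have "pairing \<Theta>\<^sub>0 G = c * pairing \<Theta>\<^sub>0 F"
      by (simp add: pairing_alt sum_distrib_left mult_ac)
    with p0 G(2)[OF \<Theta>0(2)] f(4) show False by simp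
  qed
  let ?W = "cvec.span ((\<lambda>j. mpderiv j F) ` {..<n})"
  have grad: "mpderiv i G \<in> ?W" if i: "i < n" for i
  proof (rule ccontr)
    assume "mpderiv i G \<notin> ?W"
    then obtain g :: "cpoly \<Rightarrow> complex" where g: "\<And>p q. g (p + q) = g p + g q"
      "\<And>c p. g (cscale c p) = c * g p" "\<And>u. u \<in> ?W \<Longrightarrow> g u = 0" "g (mpderiv i G) = 1"
      by (rule separating_functional[OF cvec.subspace_span]) blast
    obtain \<Theta> where \<Theta>: "\<Theta> \<in> forms n (d - 1)" "\<And>P. P \<in> forms n (d - 1) \<Longrightarrow> pairing P \<Theta> = g P"
      by (rule functional_represented[of g n "d - 1"]) (use g(1,2) in auto)
    have "pairing \<Theta> (mpderiv j F) = 0" if "j < n" for j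
      using \<Theta>(2)[OF mpderiv_forms[OF F(1)], of j] g(3)[OF cvec.span_base, of "mpderiv j F"] that
      by (simp add: pairing_commute)
    then have "apolar_act \<Theta> F = 0" using \<Theta>(1) F(1) d by (intro apolar_act_eq_0)
    then have "\<Theta> \<in> apolar_ideal n F" using forms_polys[OF \<Theta>(1)] by (simp add: apolar_ideal_def)
    then have "f (Var i * \<Theta>) = 0" by (intro f(3) Var_mult_in_ideal_product i)
    moreover have "Var i * \<Theta> \<in> forms n d" using forms_mult[OF forms_Var[OF i] \<Theta>(1)] d by simp
    ultimately have "pairing \<Theta> (mpderiv i G) = 0" using G(2) by (simp flip: pairing_Var_mult)
    then show False
      using \<Theta>(2)[OF mpderiv_forms[OF G(1)], of i] g(4) by (simp add: pairing_commute)
  qed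
  let ?D = "{dder n \<beta> F |\<beta>. \<beta> \<in> forms n 1}"
  have "?W \<subseteq> ?D"
  proof (rule cvec.span_minimal)
    show "(\<lambda>j. mpderiv j F) ` {..<n} \<subseteq> ?D"
    proof (intro image_subsetI CollectI)
      fix j assume "j \<in> {..<n}"
      then show "\<exists>\<beta>. mpderiv j F = dder n \<beta> F \<and> \<beta> \<in> forms n 1"
        by (intro exI[of _ "Var j"]) (simp add: dder_Var_left forms_Var del: One_nat_def)
    qed
    show "cvec.subspace ?D"
    proof (rule cvec.subspaceI)
      show "0 \<in> ?D" by (auto intro!: exI[of _ 0])
      show "x + y \<in> ?D" if "x \<in> ?D" "y \<in> ?D" for x y
        using that forms_add by (auto simp flip: dder_add_left simp del: One_nat_def)
      show "cscale c x \<in> ?D" if "x \<in> ?D" for c x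
        using that forms_cscale by (auto simp flip: dder_cscale_left simp del: One_nat_def)
    qed
  qed
  moreover have "dder n \<alpha> G \<in> ?W" for \<alpha>
    unfolding dder_def by (intro cvec.span_sum cvec.span_scale grad) simp
  ultimately have "\<exists>\<beta>\<in>forms n 1. dder n \<alpha> G = dder n \<beta> F" for \<alpha> by blast
  with d G(1) notmult show thesis by (rule that)
qed

section \<open>Splitting along complementary annihilators\<close>

lemma sums_span: "{v1 + v2 |v1 v2. v1 \<in> cvec.span S \<and> v2 \<in> cvec.span T} = cvec.span (S \<union> T)"
  by (auto simp: cvec.span_Un)

text \<open>The hypothesis says that the annihilators of \<open>F1\<close> and \<open>F2\<close> in \<open>V\<^sup>*\<close> together span \<open>V\<^sup>*\<close>.  Hence \<open>V\<^sup>*\<close> has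
  a basis each of whose elements annihilates \<open>F1\<close> or \<open>F2\<close>, and in the dual coordinates \<open>F1\<close> and
  \<open>F2\<close> involve disjoint sets of variables.\<close>

lemma direct_sum_of_complementary_annihilators:
  assumes F1: "F1 \<in> forms n d" "F1 \<noteq> 0" and F2: "F2 \<in> forms n d" "F2 \<noteq> 0"
    and split: "\<And>\<alpha>. \<alpha> \<in> forms n 1 \<Longrightarrow>
      \<exists>\<beta>\<in>forms n 1. dder n \<beta> F2 = 0 \<and> dder n (\<alpha> - \<beta>) F1 = 0"
  shows "is_direct_sum n d (F1 + F2)"
proof -
  let ?K = "{\<alpha> \<in> forms n 1. dder n \<alpha> F1 = 0 \<or> dder n \<alpha> F2 = 0}"
  from cvec.maximal_independent_subset[of ?K] obtain B
    where B: "B \<subseteq> ?K" "cvec.independent B" "?K \<subseteq> cvec.span B" by blast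
  have spanB: "cvec.span B = forms n 1"
  proof
    show "cvec.span B \<subseteq> forms n 1" using B(1) subspace_forms by (intro cvec.span_minimal) auto
    show "forms n 1 \<subseteq> cvec.span B"
    proof
      fix \<alpha> assume \<alpha>: "\<alpha> \<in> forms n 1"
      then obtain \<beta> where \<beta>: "\<beta> \<in> forms n 1" "dder n \<beta> F2 = 0" "dder n (\<alpha> - \<beta>) F1 = 0"
        using split by blast
      have "\<beta> \<in> cvec.span B" "\<alpha> - \<beta> \<in> cvec.span B"
        using B(3) \<beta> forms_diff[OF \<alpha> \<beta>(1)] by auto
      from cvec.span_add[OF this] show "\<alpha> \<in> cvec.span B" by simp
    qed
  qed
  have "finite B" "card B = n" using card_basis_forms[OF B(2) spanB] by auto
  then obtain e where "bij_betw e {..<n} B"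
    using ex_bij_betw_nat_finite[of B] by (auto simp: atLeast0LessThan)
  then have e: "inj_on e {..<n}" "e ` {..<n} = B" by (auto simp: bij_betw_def)
  obtain l where "dual_bases n e l"
    by (rule dual_bases_exist[of e n]) (simp_all add: e B spanB del: One_nat_def)
  then interpret dual_bases n e l .
  define I1 where "I1 = {i. i < n \<and> dder n (e i) F1 = 0}"
  define I2 where "I2 = {i. i < n \<and> dder n (e i) F1 \<noteq> 0}"
  have I2: "dder n (e i) F2 = 0" if "i \<in> I2" for i using e B(1) that by (auto simp: I2_def)
  have mem: "subst l f \<in> Sym d (cvec.span (l ` J))"
    if f: "f \<in> forms n d" "\<forall>m\<in>keys f. keys m \<inter> I = {}" and IJ: "{..<n} - I \<subseteq> J" for f I J
  proof (rule subst_Sym[OF f(1)])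
    fix m i assume mi: "m \<in> keys f" "i \<in> keys m"
    then have "i < n" using polysD[OF forms_polys[OF f(1)]] by blast
    with mi f(2) IJ have "i \<in> J" by blast
    then show "l i \<in> cvec.span (l ` J)" by (intro cvec.span_base imageI)
  qed
  obtain f1 where f1: "f1 \<in> forms n d" "F1 = subst l f1" "\<forall>m\<in>keys f1. keys m \<inter> I1 = {}"
    using adapted[OF F1(1), of I1] unfolding I1_def by blast
  have S1: "F1 \<in> Sym d (cvec.span (l ` I2))"
    unfolding f1(2) by (rule mem[OF f1(1,3)]) (auto simp: I1_def I2_def)
  obtain f2 where f2: "f2 \<in> forms n d" "F2 = subst l f2" "\<forall>m\<in>keys f2. keys m \<inter> I2 = {}"
    using adapted[OF F2(1), of I2] I2 unfolding I2_def by blast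
  have S2: "F2 \<in> Sym d (cvec.span (l ` I1))"
    unfolding f2(2) by (rule mem[OF f2(1,3)]) (auto simp: I1_def I2_def)
  have un: "l ` I2 \<union> l ` I1 = l ` {..<n}" by (auto simp: I1_def I2_def)
  have int: "cvec.span (l ` I2) \<inter> cvec.span (l ` I1) = {0}"
  proof (intro equalityI subsetI)
    fix v assume v: "v \<in> cvec.span (l ` I2) \<inter> cvec.span (l ` I1)"
    have "cvec.span (l ` I1) \<subseteq> forms n 1"
      unfolding basis(3)[symmetric] un[symmetric] by (rule cvec.span_mono) auto
    then have "v \<in> forms n 1" using v by auto
    moreover have "dder n (e i) v = 0" if "i < n" for i
    proof (cases "i \<in> I1")
      case True
      have "dder n (e i) s = 0" if "s \<in> l ` I2" for s
        using that True \<open>i < n\<close> by (auto simp: I1_def I2_def dual)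
      with v show ?thesis by (intro dder_span_eq_0[of v "l ` I2"]) auto
    next
      case False
      have "dder n (e i) s = 0" if "s \<in> l ` I1" for s
        using that False \<open>i < n\<close> by (auto simp: I1_def dual)
      with v show ?thesis by (intro dder_span_eq_0[of v "l ` I1"]) auto
    qed
    ultimately show "v \<in> {0}" using eq_0_if_dder_eq_0 by simp
  qed (auto simp: cvec.span_zero)
  show ?thesis
    unfolding is_direct_sum_def
  proof (intro conjI exI)
    show "F1 + F2 \<in> forms n d" using F1 F2 by (simp add: forms_add)
    show "{v1 + v2 |v1 v2. v1 \<in> cvec.span (l ` I2) \<and> v2 \<in> cvec.span (l ` I1)} = forms n 1"
      unfolding sums_span un by (rule basis(3))
  qed (use F1 F2 S1 S2 int in auto)
qed

section \<open>The normal form of the nilpotent case\<close>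

text \<open>A vector in both spans has a representation supported on \<open>S\<close> and one supported on \<open>T\<close>, and
  representations in the basis \<open>B\<close> are unique.\<close>

lemma span_Int_eq_0:
  assumes "cvec.independent B" and "S \<subseteq> B" and "T \<subseteq> B" and "S \<inter> T = {}"
    and "x \<in> cvec.span S" and "x \<in> cvec.span T"
  shows "x = 0"
proof -
  have "cvec.representation B x = cvec.representation S x"
    by (rule cvec.representation_extend) (use assms in auto)
  moreover have "cvec.representation B x = cvec.representation T x"
    by (rule cvec.representation_extend) (use assms in auto)
  ultimately have "cvec.representation B x v = 0" for v
    using cvec.representation_ne_zero[of S x v] cvec.representation_ne_zero[of T x v] assms(4) by auto
  moreover have "x \<in> cvec.span B" using assms cvec.span_mono by blast
  ultimately show ?thesis using cvec.sum_nonzero_representation_eq[OF assms(1), of x] by simp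
qed

lemma independent_change_part:
  assumes "finite B" and "cvec.independent (B \<union> C)" and "B \<inter> C = {}"
    and "cvec.independent C'" and "cvec.span C' = cvec.span C"
  shows "cvec.independent (B \<union> C')"
  using assms(1-3)
proof (induction B)
  case (insert b B)
  have sp: "cvec.span (B \<union> C') = cvec.span (B \<union> C)" by (simp add: cvec.span_Un assms(5))
  have "cvec.independent (insert b (B \<union> C))" "b \<notin> B \<union> C" using insert by auto
  then have "b \<notin> cvec.span (B \<union> C)" "cvec.independent (B \<union> C)"
    by (auto simp: cvec.independent_insert)
  then show ?case using insert cvec.independent_insertI[of b "B \<union> C'"] by (simp add: sp)
qed (simp add: assms(4))

text \<open>The hypotheses on \<open>G\<close> hold whenever \<open>\<alpha>\<circ>F \<mapsto> \<alpha>\<circ>G\<close> is a nonzero operator of square zero on the first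
  derivatives of \<open>F\<close>.  Let \<open>K\<close> be the annihilator of \<open>G\<close> in \<open>V\<^sup>*\<close>, let \<open>b\<close> be a basis of a complement of
  \<open>K\<close>, and choose \<open>a\<^sub>i \<in> K\<close> with \<open>b\<^sub>i\<circ>G = a\<^sub>i\<circ>F\<close>.  A linear relation among the \<open>a\<^sub>i\<close> would put the same
  combination of the \<open>b\<^sub>i\<close> into \<open>K\<close>, so the \<open>a\<^sub>i\<close> are independent and extend by some \<open>c\<^sub>j\<close> to a basis of \<open>K\<close>.

  Let \<open>y, x, z\<close> be the basis of \<open>V\<close> dual to the basis \<open>b, a, c\<close> of \<open>V\<^sup>*\<close>.  As \<open>a\<close> and \<open>c\<close> annihilate \<open>G\<close>, the
  form \<open>G\<close> is a polynomial \<open>g\<close> in \<open>y\<close> alone.  Moreover \<open>\<partial>F/\<partial>x\<^sub>i = a\<^sub>i\<circ>F = b\<^sub>i\<circ>G = \<partial>g/\<partial>y\<^sub>i\<close>, hence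
  \<open>F - \<Sum> x\<^sub>i \<partial>g/\<partial>y\<^sub>i\<close> is annihilated by every \<open>a\<^sub>i\<close> and does not involve \<open>x\<close>.  In the list \<open>l\<close> the
  coordinates are ordered as \<open>y, x, z\<close>, so that \<open>g\<close> is a form in the first \<open>k\<close> variables.\<close>

lemma nilpotent_normal_form:
  assumes F: "F \<in> forms n d" and G: "G \<in> forms n d" "G \<noteq> 0" and d: "d \<ge> 1"
    and nil: "\<And>\<alpha>. \<alpha> \<in> forms n 1 \<Longrightarrow>
      \<exists>\<beta>\<in>forms n 1. dder n \<alpha> G = dder n \<beta> F \<and> dder n \<beta> G = 0"
  obtains k e l g q where "1 \<le> k" and "2 * k \<le> n" and "dual_bases n e l"
    and "g \<in> forms k d" and "G = subst l g" and "q \<in> forms n d"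
    and "\<And>m i. m \<in> keys q \<Longrightarrow> i \<in> keys m \<Longrightarrow> i < k \<or> 2 * k \<le> i"
    and "F = (\<Sum>i<k. l (k + i) * subst l (mpderiv i g)) + subst l q"
proof -
  let ?K = "{\<alpha> \<in> forms n 1. dder n \<alpha> G = 0}"
  have K: "cvec.subspace ?K"
    by (rule cvec.subspaceI) (auto simp: forms_add forms_cscale dder_add_left dder_cscale_left)
  obtain C where C: "C \<subseteq> ?K" "cvec.independent C" "?K \<subseteq> cvec.span C"
    using cvec.maximal_independent_subset[of ?K] by blast
  have spanC: "cvec.span C = ?K" using C K by (intro cvec.span_subspace)
  obtain B where B: "C \<subseteq> B" "B \<subseteq> forms n 1" "cvec.independent B" "forms n 1 \<subseteq> cvec.span B"
    using cvec.maximal_independent_subset_extend[of C "forms n 1"] C by auto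
  have spanB: "cvec.span B = forms n 1" using B subspace_forms by (intro cvec.span_subspace)
  have finB: "finite B" and cardB: "card B = n" using card_basis_forms[OF B(3) spanB] by auto
  \<comment> \<open>The span of \<open>Bs\<close> is a complement of the annihilator of \<open>G\<close>.\<close>
  define Bs where "Bs = B - C"
  define k where "k = card Bs"
  have finBs: "finite Bs" using finB by (simp add: Bs_def)
  have Bs: "Bs \<union> C = B" "Bs \<inter> C = {}" "Bs \<subseteq> B" using B(1) by (auto simp: Bs_def)
  have BsK: "x = 0" if "x \<in> cvec.span Bs" "x \<in> ?K" for x
    using span_Int_eq_0[OF B(3) Bs(3) B(1) Bs(2) that(1)] that(2) spanC by simp
  have k1: "1 \<le> k"
  proof (rule ccontr)
    assume "\<not> 1 \<le> k"
    then have "Bs = {}" using finBs by (simp add: k_def Suc_le_eq card_gt_0_iff)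
    then have "forms n 1 = ?K" using Bs(1) spanB spanC by simp
    then have "G = 0" using dder_eq_0[OF G(1) d] by blast
    with G(2) show False by simp
  qed
  obtain b where "bij_betw b {..<k} Bs"
    using ex_bij_betw_nat_finite[OF finBs] by (auto simp: atLeast0LessThan k_def)
  then have b: "inj_on b {..<k}" "b ` {..<k} = Bs" by (auto simp: bij_betw_def)
  have "\<exists>\<beta>\<in>forms n 1. dder n (b i) G = dder n \<beta> F \<and> dder n \<beta> G = 0" if "i < k" for i
    using nil[of "b i"] b(2) B(2) Bs(3) that by blast
  then obtain a where a: "\<And>i. i < k \<Longrightarrow> a i \<in> forms n 1" "\<And>i. i < k \<Longrightarrow> dder n (b i) G = dder n (a i) F"
    "\<And>i. i < k \<Longrightarrow> dder n (a i) G = 0" by metis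
  have aK: "a ` {..<k} \<subseteq> ?K" using a by auto
  have "c i = 0" if c: "(\<Sum>j<k. cscale (c j) (a j)) = 0" and "i < k" for c i
  proof -
    let ?x = "\<Sum>j<k. cscale (c j) (b j)"
    have xs: "?x \<in> cvec.span Bs"
      using b(2) by (intro cvec.span_sum cvec.span_scale cvec.span_base) auto
    moreover have "cvec.span Bs \<subseteq> forms n 1" using cvec.span_mono[OF Bs(3)] spanB by simp
    moreover have "dder n ?x G = dder n (\<Sum>j<k. cscale (c j) (a j)) F"
      by (simp add: dder_sum_left dder_cscale_left a(2))
    ultimately have "?x = 0" using c by (intro BsK) auto
    then show "c i = 0"
      using independent_image_lessThan[OF b(1), of c "\<lambda>_. 0" i] \<open>i < k\<close> b(2)
        cvec.independent_mono[OF B(3) Bs(3)] by simp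
  qed
  then have *: "\<And>c. (\<Sum>j<k. cscale (c j) (a j)) = 0 \<Longrightarrow> \<forall>j<k. c j = 0" by blast
  have inja: "inj_on a {..<k}" by (rule independent_image_lessThanI(1)[OF *])
  have inda: "cvec.independent (a ` {..<k})" by (rule independent_image_lessThanI(2)[OF *])
  obtain C' where C': "a ` {..<k} \<subseteq> C'" "C' \<subseteq> ?K" "cvec.independent C'" "?K \<subseteq> cvec.span C'"
    using cvec.maximal_independent_subset_extend[OF aK inda] by blast
  have spanC': "cvec.span C' = ?K" using C' K by (intro cvec.span_subspace)
  have ind: "cvec.independent (Bs \<union> C')"
    by (rule independent_change_part[OF finBs _ Bs(2) C'(3)]) (simp_all add: Bs B(3) spanC spanC')
  have span: "cvec.span (Bs \<union> C') = forms n 1"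
    using spanB by (simp add: cvec.span_Un spanC spanC' flip: Bs(1))
  have fin: "finite (Bs \<union> C')" and card: "card (Bs \<union> C') = n" using card_basis_forms[OF ind span] by auto
  have "x \<notin> Bs" if "x \<in> C'" for x
  proof
    assume "x \<in> Bs"
    then have "x = 0" using that C'(2) cvec.span_base by (intro BsK) auto
    then show False using \<open>x \<in> Bs\<close> Bs(3) B(3) cvec.dependent_zero by blast
  qed
  then have "card (Bs \<union> C') = k + card C'" using fin by (subst card_Un_disjoint) (auto simp: k_def)
  define Cs where "Cs = C' - a ` {..<k}"
  have "card C' = k + card Cs"
    using card_mono[of C' "a ` {..<k}"] fin C'(1) by (simp add: Cs_def card_Diff_subset card_image[OF inja])
  then have n: "2 * k \<le> n" "card Cs = n - 2 * k"
    using card \<open>card (Bs \<union> C') = k + card C'\<close> by auto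
  obtain c where "bij_betw c {..<n - 2 * k} Cs"
    using ex_bij_betw_nat_finite[of Cs] fin n(2) by (auto simp: atLeast0LessThan Cs_def)
  then have c: "c ` {..<n - 2 * k} = Cs" by (auto simp: bij_betw_def)
  define e where "e i = (if i < k then b i else if i < 2 * k then a (i - k) else c (i - 2 * k))" for i
  have shift: "f ` {m..<m + r} = (\<lambda>i. f (m + i)) ` {..<r}" for f :: "nat \<Rightarrow> cpoly" and m r
  proof -
    have "{m..<m + r} = (+) m ` {..<r}"
      using image_add_atLeastLessThan[of m 0 r] by (simp add: atLeast0LessThan add.commute)
    then show ?thesis by (simp add: image_image)
  qed
  have "e ` {..<n} = e ` ({..<k} \<union> {k..<2 * k} \<union> {2 * k..<n})"
    using n(1) by (intro arg_cong[where f = "image e"]) auto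
  also have "\<dots> = Bs \<union> a ` {..<k} \<union> Cs"
  proof -
    have "e ` {..<k} = Bs" unfolding b(2)[symmetric] by (auto simp: e_def)
    moreover have "e ` {k..<2 * k} = a ` {..<k}"
      using shift[of e k k] by (simp add: e_def mult_2)
    moreover have "e ` {2 * k..<n} = Cs"
      using shift[of e "2 * k" "n - 2 * k"] n(1) by (simp add: e_def c)
    ultimately show ?thesis by (simp only: image_Un)
  qed
  also have "\<dots> = Bs \<union> C'" using C'(1) by (auto simp: Cs_def)
  finally have e: "e ` {..<n} = Bs \<union> C'" .
  then have "inj_on e {..<n}" using card by (intro eq_card_imp_inj_on) auto
  then obtain l where "dual_bases n e l"
    using dual_bases_exist[of e n] ind span unfolding e by blast
  then interpret dual_bases n e l .
  have "dder n (e i) G = 0" if "i \<in> {k..<n}" for i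
  proof (cases "i < 2 * k")
    case True
    then show ?thesis using that a(3) by (simp add: e_def)
  next
    case False
    then have "c (i - 2 * k) \<in> Cs" using that by (auto simp flip: c)
    then show ?thesis using that False C'(2) by (auto simp: e_def Cs_def)
  qed
  with adapted[OF G(1), of "{k..<n}"] obtain g
    where g: "g \<in> forms n d" "G = subst l g" "\<forall>m\<in>keys g. keys m \<inter> {k..<n} = {}" by auto
  have "keys m \<subseteq> {..<k}" if "m \<in> keys g" for m
    using polysD[OF forms_polys[OF g(1)] that] g(3) that by fastforce
  then have gk: "g \<in> forms k d" using forms_mdeg[OF g(1)] by (intro formsI polysI)
  define S where "S i = subst l (mpderiv i g)" for i
  define R where "R = F - (\<Sum>i<k. l (k + i) * S i)"
  have Sf: "S i \<in> forms n (d - 1)" for i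
    unfolding S_def by (rule subst_forms[OF l_form mpderiv_forms[OF g(1)]])
  have R: "R \<in> forms n d"
    unfolding R_def
  proof (intro forms_diff F forms_sum)
    fix i assume "i \<in> {..<k}"
    then have "l (k + i) \<in> forms n 1" using n(1) by (intro l_form) auto
    from forms_mult[OF this Sf] show "l (k + i) * S i \<in> forms n d" using d by simp
  qed
  have "dder n (e i) R = 0" if i: "i \<in> {k..<2 * k}" for i
  proof -
    define j where "j = i - k"
    have j: "i = k + j" "j < k" using i by (auto simp: j_def)
    have "dder n (e i) F = dder n (e j) G" using j by (simp add: e_def a(2))
    also have "\<dots> = S j"
      unfolding g(2) S_def using j n(1) by (intro dder_subst forms_polys[OF g(1)]) auto
    finally have "dder n (e i) F = S j" .
    moreover have "dder n (e i) (l (k + i') * S i') = (if j = i' then S i' else 0)" if "i' < k" for i'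
    proof -
      have "mpderiv i g = 0" using g(3) i n(1) by (fastforce simp: mpderiv_eq_0_iff)
      then have "mpderiv i (mpderiv i' g) = 0" by (simp add: mpderiv_commute[of i])
      then have "dder n (e i) (S i') = 0"
        unfolding S_def using i n(1) by (subst dder_subst) (auto intro: mpderiv_polys forms_polys g)
      then show ?thesis using j that n(1) by (simp add: dder_mult dual)
    qed
    ultimately show ?thesis using j(2) by (simp add: R_def dder_diff dder_sum)
  qed
  with adapted[OF R, of "{k..<2 * k}"] n(1) obtain q
    where q: "q \<in> forms n d" "R = subst l q" "\<forall>m\<in>keys q. keys m \<inter> {k..<2 * k} = {}" by auto
  have "F = (\<Sum>i<k. l (k + i) * subst l (mpderiv i g)) + subst l q"
    by (simp flip: q(2) add: R_def S_def)
  moreover have "i < k \<or> 2 * k \<le> i" if "m \<in> keys q" "i \<in> keys m" for m i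
    using q(3) that by fastforce
  ultimately show thesis
    using that[OF k1 n(1) \<open>dual_bases n e l\<close> gk g(2) q(1)] by blast
qed

section \<open>Degeneration of direct sums\<close>

text \<open>Writing the remainder as a univariate polynomial with coefficients in the polynomial ring,
  evaluated at \<open>t\<close>, makes each of its coefficients a polynomial function of \<open>t\<close>, hence
  continuous.\<close>

lemma taylor_expansion:
  assumes "g \<in> polys k"
  obtains E :: "cpoly poly" where "\<And>t. subst (\<lambda>i. y i + Const t * x i) g =
    subst y g + Const t * (\<Sum>i<k. x i * subst y (mpderiv i g)) + Const t * Const t * poly E (Const t)"
proof -
  let ?L = "\<lambda>g t. subst (\<lambda>i. y i + Const t * x i) g"
  let ?D = "\<lambda>g. \<Sum>i<k. x i * subst y (mpderiv i g)"
  have "\<exists>E. \<forall>t. ?L g t = subst y g + Const t * ?D g + Const t * Const t * poly E (Const t)"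
    using assms
  proof (induction rule: polys_induct)
    case (Const c)
    show ?case by (rule exI[of _ 0]) simp
  next
    case (Var i)
    then show ?case
      by (intro exI[of _ 0]) (simp add: mpderiv_Var if_distrib cong: if_cong)
  next
    case (add p q)
    then obtain A B where "\<forall>t. ?L p t = subst y p + Const t * ?D p + Const t * Const t * poly A (Const t)"
      "\<forall>t. ?L q t = subst y q + Const t * ?D q + Const t * Const t * poly B (Const t)" by blast
    then show ?case
      by (intro exI[of _ "A + B"]) (simp add: subst_add mpderiv_add distrib_left sum.distrib)
  next
    case (mult p q)
    then obtain A B where AB: "\<forall>t. ?L p t = subst y p + Const t * ?D p + Const t * Const t * poly A (Const t)"
      "\<forall>t. ?L q t = subst y q + Const t * ?D q + Const t * Const t * poly B (Const t)" by blast
    have D: "?D (p * q) = ?D p * subst y q + subst y p * ?D q"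
      by (simp add: mpderiv_mult subst_add subst_mult distrib_left sum.distrib sum_distrib_left
          sum_distrib_right mult_ac)
    define P P' Q Q' where "P = subst y p" and "P' = ?D p" and "Q = subst y q" and "Q' = ?D q"
    show ?case
      unfolding subst_mult D AB[rule_format]
      unfolding P_def[symmetric] P'_def[symmetric] Q_def[symmetric] Q'_def[symmetric]
      by (intro exI[of _ "[:P' * Q':] + [:P, P':] * B + [:Q, Q':] * A + [:0, 0, 1:] * A * B"] allI)
        (simp add: algebra_simps)
  qed
  with that show thesis by blast
qed

lemma continuous_lookup_poly:
  "continuous_on UNIV (\<lambda>t. lookup (poly E (Const t)) m)"
proof (induction E)
  case (pCons a E)
  then show ?case by (auto simp: lookup_add intro!: continuous_intros)
qed simp

lemma eventually_neq_0:
  fixes f :: "complex \<Rightarrow> complex"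
  assumes "continuous_on UNIV f" and "f 0 \<noteq> 0"
  shows "\<forall>\<^sub>F t in at 0. f t \<noteq> 0"
proof -
  have "(f \<longlongrightarrow> f 0) (at 0)" using assms(1) by (simp add: continuous_on_def)
  then show ?thesis using assms(2) by (rule tendsto_imp_eventually_ne)
qed

text \<open>Put \<open>y\<^sub>i = l i\<close> and \<open>x\<^sub>i = l (k + i)\<close> for \<open>i < k\<close>, and \<open>z\<^sub>i = l (2 k + i)\<close>.  The sum \<open>\<Sum> x\<^sub>i \<partial>g/\<partial>y\<^sub>i\<close> is
  the derivative at \<open>t = 0\<close> of \<open>g(y + t x)\<close>, so \<open>F\<close> is the limit for \<open>t \<rightarrow> 0\<close> of
  \<open>F\<^sub>t = g(y + t x) / t + (q(y, z) - g(y) / t)\<close>.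
  For \<open>t \<noteq> 0\<close> the forms \<open>y + t x\<close> and \<open>y, z\<close> span complementary subspaces; the two summands are
  nonzero for small \<open>t \<noteq> 0\<close> because, after multiplication by \<open>t\<close>, they tend to \<open>g(y)\<close> and \<open>-g(y)\<close>.\<close>

lemma (in dual_bases) limit_of_direct_sums:
  assumes n: "2 * k \<le> n" and g: "g \<in> forms k d" "subst l g \<noteq> 0" and q: "q \<in> forms n d"
    and supp: "\<And>m i. m \<in> keys q \<Longrightarrow> i \<in> keys m \<Longrightarrow> i < k \<or> 2 * k \<le> i"
    and F: "F \<in> forms n d" "F = (\<Sum>i<k. l (k + i) * subst l (mpderiv i g)) + subst l q"
  shows "is_limit_of_direct_sums n d F"
proof -
  define J where "J = {..<k} \<union> {2 * k..<n}"
  define b where "b t i = l i + Const t * l (k + i)" for t i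
  define G where "G = subst l g"
  define Q where "Q = subst l q"
  obtain E where E: "\<And>t. subst (b t) g =
      G + Const t * (\<Sum>i<k. l (k + i) * subst l (mpderiv i g)) + Const t * Const t * poly E (Const t)"
    using taylor_expansion[OF forms_polys[OF g(1)], of l "\<lambda>i. l (k + i)"] unfolding b_def G_def by blast
  obtain m0 where m0: "lookup G m0 \<noteq> 0"
    using g(2) by (metis G_def poly_mapping_eqI lookup_zero)
  have bf: "b t i \<in> forms n 1" if "i < k" for t i
    using that n forms_cscale[OF l_form, of "k + i" t]
    by (auto simp: b_def simp del: One_nat_def simp flip: cscale_def intro!: forms_add l_form)
  have ds: "is_direct_sum n d (F + Const t * poly E (Const t))"
    if t: "t \<noteq> 0" and 1: "subst (b t) g \<noteq> 0" and 2: "cscale t Q - G \<noteq> 0" for t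
  proof -
    define F1 where "F1 = subst (b t) (cscale (1 / t) g)"
    define F2 where "F2 = Q - cscale (1 / t) G"
    have tt: "Const (1 / t) * Const t = 1" using t by (simp flip: Const_mult)
    have "F1 = cscale (1 / t) G + (Const (1 / t) * Const t) * (\<Sum>i<k. l (k + i) * subst l (mpderiv i g)) +
        (Const (1 / t) * Const t) * (Const t * poly E (Const t))"
      unfolding F1_def subst_cscale E by (simp only: cscale_def distrib_left mult.assoc)
    then have sum: "F + Const t * poly E (Const t) = F1 + F2"
      unfolding tt by (simp add: F2_def F(2) Q_def)
    have F1: "F1 \<noteq> 0" using 1 t by (simp add: F1_def subst_cscale)
    have "cscale t F2 = cscale t Q - G" using t by (simp add: F2_def cvec.scale_right_diff_distrib)
    then have F2: "F2 \<noteq> 0" using 2 by auto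
    let ?V1 = "cvec.span (b t ` {..<k})" and ?V2 = "cvec.span (l ` J)"
    have k0: "keys m \<subseteq> {..<k}" if "m \<in> keys g" for m using that polysD[OF forms_polys[OF g(1)]] by blast
    have S1: "F1 \<in> Sym d ?V1"
      unfolding F1_def
      by (rule subst_Sym[OF forms_cscale[OF g(1)]], rule cvec.span_base) (use k0 keys_cscale in blast)
    have S2: "F2 \<in> Sym d ?V2"
    proof -
      have "F2 = subst l (q + cscale (- 1 / t) g)"
        by (simp add: F2_def Q_def G_def subst_diff subst_cscale)
      also have "\<dots> \<in> Sym d ?V2"
      proof -
        have "keys m \<subseteq> {..<n}" if "m \<in> keys g" for m using k0[OF that] n by fastforce
        then have "g \<in> forms n d" using forms_mdeg[OF g(1)] by (intro formsI polysI)
        then have qg: "q + cscale (- 1 / t) g \<in> forms n d" by (intro forms_add q forms_cscale)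
        show ?thesis
        proof (rule subst_Sym[OF qg])
          fix m i assume m: "m \<in> keys (q + cscale (- 1 / t) g)" "i \<in> keys m"
          then have "i < n" using polysD[OF forms_polys[OF qg]] by blast
          have "m \<in> keys q \<or> m \<in> keys g"
            using m(1) keys_add[of q "cscale (- 1 / t) g"] keys_cscale[of "- 1 / t" g] by blast
          then have "i \<in> J"
          proof
            assume "m \<in> keys q"
            then show ?thesis using supp[OF _ m(2)] \<open>i < n\<close> by (auto simp: J_def)
          next
            assume "m \<in> keys g"
            then show ?thesis using k0 m(2) by (auto simp: J_def)
          qed
          then show "l i \<in> cvec.span (l ` J)" by (intro cvec.span_base imageI)
        qed
      qed
      finally show ?thesis .
    qed
    have Jn: "l ` J \<subseteq> forms n 1" using n by (auto simp: J_def simp del: One_nat_def intro!: l_form)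
    have bn: "b t ` {..<k} \<subseteq> forms n 1" using bf by auto
    have "l j \<in> cvec.span (b t ` {..<k} \<union> l ` J)" if j: "j < n" for j
    proof (cases "j \<in> J")
      case True
      then show ?thesis by (intro cvec.span_base) auto
    next
      case False
      define i where "i = j - k"
      have i: "j = k + i" "i < k" using False j by (auto simp: J_def i_def)
      have "l j = cscale (1 / t) (b t i - l i)"
        using t by (simp add: b_def i cscale_def flip: mult.assoc Const_mult)
      also have "\<dots> \<in> cvec.span (b t ` {..<k} \<union> l ` J)"
        using i(2) by (intro cvec.span_scale cvec.span_diff cvec.span_base) (auto simp: J_def)
      finally show ?thesis .
    qed
    then have "cvec.span (l ` {..<n}) \<subseteq> cvec.span (b t ` {..<k} \<union> l ` J)"
      by (intro cvec.span_minimal) auto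
    moreover have "cvec.span (b t ` {..<k} \<union> l ` J) \<subseteq> forms n 1"
      using Jn bn subspace_forms by (intro cvec.span_minimal) auto
    ultimately have span: "cvec.span (b t ` {..<k} \<union> l ` J) = forms n 1" using basis(3) by auto
    have int: "?V1 \<inter> ?V2 = {0}"
    proof (intro equalityI subsetI)
      fix v assume v: "v \<in> ?V1 \<inter> ?V2"
      have vn: "v \<in> forms n 1" using v Jn subspace_forms cvec.span_minimal by blast
      have x: "dder n (e (k + i)) v = 0" if "i < k" for i
      proof (rule dder_span_eq_0[of v "l ` J"])
        fix s assume "s \<in> l ` J"
        then show "dder n (e (k + i)) s = 0" using that n by (auto simp: J_def dual)
      qed (use v in auto)
      have "dder n (e i) v = 0" if i: "i < n" for i
      proof -
        consider "i < k" | "k \<le> i" "i < 2 * k" | "2 * k \<le> i" by linarith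
        then show ?thesis
        proof cases
          case 1
          \<comment> \<open>This functional vanishes on every \<open>y\<^sub>j + t x\<^sub>j\<close>.\<close>
          have "dder n (e i - cscale (1 / t) (e (k + i))) v = 0"
          proof (rule dder_span_eq_0[of v "b t ` {..<k}"])
            fix s assume "s \<in> b t ` {..<k}"
            then obtain j where j: "s = b t j" "j < k" by auto
            have "dder n (e i) s = (if i = j then 1 else 0)"
              "dder n (e (k + i)) s = (if i = j then Const t else 0)"
              using 1 n j(2) by (auto simp: j(1) b_def dder_add dder_mult dual)
            moreover have "cscale (1 / t) (Const t) = 1" by (simp add: cscale_def tt)
            ultimately show "dder n (e i - cscale (1 / t) (e (k + i))) s = 0"
              by (simp add: dder_diff_left dder_cscale_left)
          qed (use v in auto)
          then show ?thesis using x[OF 1] by (simp add: dder_diff_left dder_cscale_left)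
        next
          case 2
          then show ?thesis using x[of "i - k"] by simp
        next
          case 3
          show ?thesis
          proof (rule dder_span_eq_0[of v "b t ` {..<k}"])
            fix s assume "s \<in> b t ` {..<k}"
            then show "dder n (e i) s = 0"
              using 3 i n by (auto simp: b_def dder_add dder_mult dual)
          qed (use v in auto)
        qed
      qed
      with vn show "v \<in> {0}" using eq_0_if_dder_eq_0 by simp
    qed (auto simp: cvec.span_zero)
    show ?thesis
      unfolding is_direct_sum_def sum
    proof (intro conjI exI)
      have "F1 \<in> forms n d" unfolding F1_def by (rule subst_forms[OF bf forms_cscale[OF g(1)]])
      moreover have "G \<in> forms n d" 
        unfolding G_def using n by (intro subst_forms[OF _ g(1)] l_form) auto
      moreover have "Q \<in> forms n d" unfolding Q_def by (rule subst_forms[OF l_form q])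
      ultimately show "F1 + F2 \<in> forms n d"
        unfolding F2_def by (intro forms_add forms_diff forms_cscale)
      show "{v1 + v2 |v1 v2. v1 \<in> ?V1 \<and> v2 \<in> ?V2} = forms n 1"
        unfolding sums_span by (rule span)
    qed (use F1 F2 S1 S2 int in auto)
  qed
  have c1: "continuous_on UNIV (\<lambda>t. lookup (subst (b t) g) m0)"
    unfolding E by (auto simp: lookup_add mult.assoc intro!: continuous_intros continuous_lookup_poly)
  have ev1: "\<forall>\<^sub>F t in at 0. lookup (subst (b t) g) m0 \<noteq> 0"
    by (rule eventually_neq_0[OF c1]) (simp add: E m0)
  have ev2: "\<forall>\<^sub>F t in at 0. lookup (cscale t Q - G) m0 \<noteq> 0"
    by (rule eventually_neq_0) (auto simp: lookup_minus m0 intro!: continuous_intros)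
  have ev3: "\<forall>\<^sub>F t in at (0::complex). t \<noteq> 0" by (rule eventually_neq_at_within)
  let ?\<Phi> = "\<lambda>t. lookup (F + Const t * poly E (Const t))"
  let ?A = "closure (lookup ` {P. is_direct_sum n d P})"
  have "\<forall>\<^sub>F t in at 0. ?\<Phi> t \<in> ?A"
    using ev1 ev2 ev3
  proof eventually_elim
    case (elim t)
    then have "is_direct_sum n d (F + Const t * poly E (Const t))" by (intro ds) auto
    then show ?case by (intro subsetD[OF closure_subset]) auto
  qed
  moreover have "continuous_on UNIV ?\<Phi>"
    by (rule continuous_on_coordinatewise_then_product)
      (auto simp: lookup_add intro!: continuous_intros continuous_lookup_poly)
  then have "(?\<Phi> \<longlongrightarrow> ?\<Phi> 0) (at 0)" unfolding continuous_on_def by blast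
  ultimately have "?\<Phi> 0 \<in> ?A" by (intro Lim_in_closed_set[of ?A ?\<Phi> "at 0"]) auto
  then show ?thesis using F(1) by (simp add: is_limit_of_direct_sums_def)
qed

section \<open>Idempotents and nilpotents in a quotient of a polynomial ring\<close>

text \<open>In a generator \<open>m\<close> of the ideal \<open>I\<close> split off a root: \<open>m = (X - z)\<^sup>k r\<close> with \<open>r(z) \<noteq> 0\<close>.  If \<open>r\<close> is
  constant then \<open>k \<ge> 2\<close>, and \<open>(X - z)\<^sup>k\<^sup>-\<^sup>1\<close> is a nonzero element of square zero in the quotient.
  Otherwise the two factors are coprime and the quotient has a nontrivial idempotent.\<close>

lemma poly_ideal_idempotent_or_nilpotent:
  fixes I :: "complex poly set"
  assumes add: "\<And>p q. p \<in> I \<Longrightarrow> q \<in> I \<Longrightarrow> p + q \<in> I" and mult: "\<And>p q. p \<in> I \<Longrightarrow> q * p \<in> I"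
    and nonzero: "p\<^sub>0 \<in> I" "p\<^sub>0 \<noteq> 0"
    and linear: "\<And>p. p \<in> I \<Longrightarrow> degree p \<le> 1 \<Longrightarrow> p = 0"
  obtains (nilpotent) p where "p \<notin> I" "p * p \<in> I"
  | (idempotent) u where "u \<notin> I" "1 - u \<notin> I" "u * (1 - u) \<in> I"
proof -
  obtain m where m: "m \<in> I" "m \<noteq> 0" and least: "\<And>p. p \<in> I \<Longrightarrow> p \<noteq> 0 \<Longrightarrow> degree m \<le> degree p"
    using ex_has_least_nat[of "\<lambda>p. p \<in> I \<and> p \<noteq> 0" p\<^sub>0 degree] nonzero by blast
  have dvd: "m dvd p" if "p \<in> I" for p
  proof (rule ccontr)
    assume "\<not> m dvd p"
    then have "p mod m \<noteq> 0" by (simp add: dvd_eq_mod_eq_0)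
    moreover have "p mod m = p + (- (p div m)) * m"
      by (simp add: minus_div_mult_eq_mod)
    then have "p mod m \<in> I" using that m(1) add mult by metis
    ultimately show False
      using least[of "p mod m"] degree_mod_less'[OF m(2), of p] by auto
  qed
  have deg: "degree m \<ge> 2" using linear[OF m(1)] m(2) by linarith
  then have "\<not> constant (poly m)" by (simp add: constant_degree)
  then obtain z where z: "poly m z = 0" using fundamental_theorem_of_algebra by blast
  define k where "k = order z m"
  define a where "a = [:- z, 1:] ^ k"
  obtain r where r: "m = a * r" "\<not> [:- z, 1:] dvd r"
    using order_decomp[OF m(2), of z] by (auto simp: k_def a_def)
  have k: "k \<ge> 1" using z m(2) by (simp add: k_def order_root Suc_le_eq)
  have dega: "degree a = k" by (simp add: a_def degree_linear_power)
  show thesis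
  proof (cases "degree r = 0")
    case True
    then obtain c where c: "r = [:c:]" by (rule degree_eq_zeroE)
    have "c \<noteq> 0" using m(2) r(1) c by auto
    then have m': "m = smult c a" by (simp add: r(1) c)
    then have k2: "k \<ge> 2" using deg dega \<open>c \<noteq> 0\<close> by simp
    define p where "p = [:- z, 1:] ^ (k - 1)"
    have "p \<noteq> 0" "degree p = k - 1" by (simp_all add: p_def degree_linear_power)
    then have "p \<notin> I" using least[of p] m' dega \<open>c \<noteq> 0\<close> k by auto
    moreover have "a dvd p * p"
      unfolding a_def p_def using k2 by (simp add: le_imp_power_dvd flip: power_add)
    then have "m dvd p * p" unfolding m' using \<open>c \<noteq> 0\<close> by (intro smult_dvd)
    then have "p * p \<in> I" using mult[OF m(1)] by (auto simp: dvd_def mult.commute)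
    ultimately show thesis by (rule nilpotent)
  next
    case False
    have rz: "poly r z \<noteq> 0" using r(2) by (simp add: poly_eq_0_iff_dvd)
    \<comment> \<open>\<open>w\<close> vanishes at \<open>z\<close> and is congruent to \<open>1\<close> modulo \<open>r\<close>; so \<open>w\<^sup>k\<close> is congruent to \<open>0\<close> modulo \<open>(X - z)\<^sup>k\<close> and to \<open>1\<close> modulo \<open>r\<close>.\<close>
    define w where "w = 1 - smult (1 / poly r z) r"
    have "poly w z = 0" using rz by (simp add: w_def)
    then have "[:- z, 1:] dvd w" by (simp add: poly_eq_0_iff_dvd)
    then have aw: "a dvd w ^ k" unfolding a_def by (rule dvd_power_same)
    have "r dvd 1 - w" by (simp add: w_def dvd_smult)
    also have "1 - w dvd 1 - w ^ k" using one_diff_power_eq[of w k] by simp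
    finally have rw: "r dvd 1 - w ^ k" .
    have "w ^ k \<notin> I"
    proof
      assume "w ^ k \<in> I"
      then have "r dvd w ^ k" using dvd r(1) by (metis dvd_mult_right)
      then have "r dvd 1" using rw by (metis dvd_add diff_add_cancel)
      then show False using False dvd_imp_degree_le[of r 1] by simp
    qed
    moreover have "1 - w ^ k \<notin> I"
    proof
      assume "1 - w ^ k \<in> I"
      then have "a dvd 1 - w ^ k" using dvd r(1) by (metis dvd_mult_left)
      then have "a dvd 1" using aw by (metis dvd_add diff_add_cancel)
      then show False using dega k dvd_imp_degree_le[of a 1] by simp
    qed
    moreover have "m dvd w ^ k * (1 - w ^ k)" unfolding r(1) using aw rw by (rule mult_dvd_mono)
    then have "w ^ k * (1 - w ^ k) \<in> I" using mult[OF m(1)] by (auto simp: dvd_def mult.commute)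
    ultimately show thesis by (rule idempotent)
  qed
qed

section \<open>Polynomials in a self-adjoint operator\<close>

text \<open>The operator \<open>B\<close> on \<open>V\<^sup>*\<close> is self-adjoint for the symmetric bilinear map \<open>(\<alpha>, \<beta>) \<mapsto> \<alpha>\<beta>\<circ>F\<close>, whose
  values are polynomials.\<close>

locale selfadjoint_operator =
  fixes n d :: nat and F :: cpoly and B :: "cpoly \<Rightarrow> cpoly"
  assumes F: "F \<in> forms n d" and d: "d \<ge> 1"
    and B_form: "\<alpha> \<in> forms n 1 \<Longrightarrow> B \<alpha> \<in> forms n 1"
    and B_add: "B (\<alpha> + \<beta>) = B \<alpha> + B \<beta>"
    and B_cscale: "B (cscale c \<alpha>) = cscale c (B \<alpha>)"
    and selfadjoint: "dder n \<beta> (dder n (B \<alpha>) F) = dder n \<alpha> (dder n (B \<beta>) F)"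
begin

definition poly_op :: "complex poly \<Rightarrow> cpoly \<Rightarrow> cpoly" where
  "poly_op p = fold_coeffs (\<lambda>c g \<alpha>. cscale c \<alpha> + B (g \<alpha>)) p (\<lambda>_. 0)"

lemma B_0 [simp]: "B 0 = 0"
  using B_cscale[of 0 0] by simp

lemma poly_op_0 [simp]: "poly_op 0 \<alpha> = 0"
  by (simp add: poly_op_def)

lemma poly_op_pCons: "poly_op (pCons c p) \<alpha> = cscale c \<alpha> + B (poly_op p \<alpha>)"
proof (cases "c = 0 \<and> p = 0")
  case False
  then consider "c \<noteq> 0" | "p \<noteq> 0" by blast
  then show ?thesis by cases (simp_all add: poly_op_def)
qed simp

lemma poly_op_form: "\<alpha> \<in> forms n 1 \<Longrightarrow> poly_op p \<alpha> \<in> forms n 1"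
proof (induction p)
  case (pCons c p)
  then show ?case unfolding poly_op_pCons by (intro forms_add forms_cscale B_form)
qed simp

lemma poly_op_add_right: "poly_op p (\<alpha> + \<beta>) = poly_op p \<alpha> + poly_op p \<beta>"
  by (induction p) (simp_all add: poly_op_pCons B_add cvec.scale_right_distrib)

lemma poly_op_cscale: "poly_op p (cscale c \<alpha>) = cscale c (poly_op p \<alpha>)"
  by (induction p) (simp_all add: poly_op_pCons B_cscale cvec.scale_right_distrib mult.commute)

lemma poly_op_zero_right [simp]: "poly_op p 0 = 0"
  using poly_op_cscale[of p 0 0] by simp

lemma poly_op_sum_right: "poly_op p (\<Sum>x\<in>A. f x) = (\<Sum>x\<in>A. poly_op p (f x))"
  by (induction A rule: infinite_finite_induct) (simp_all add: poly_op_add_right)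

lemma poly_op_B: "poly_op p (B \<alpha>) = B (poly_op p \<alpha>)"
  by (induction p) (simp_all add: poly_op_pCons B_add B_cscale)

lemma poly_op_add: "poly_op (p + q) \<alpha> = poly_op p \<alpha> + poly_op q \<alpha>"
  by (induction p q rule: poly_induct2)
    (simp_all add: poly_op_pCons B_add cvec.scale_left_distrib)

lemma poly_op_smult: "poly_op (smult c p) \<alpha> = cscale c (poly_op p \<alpha>)"
  by (induction p) (simp_all add: poly_op_pCons B_cscale cvec.scale_right_distrib)

lemma poly_op_mult: "poly_op (p * q) \<alpha> = poly_op p (poly_op q \<alpha>)"
  by (induction p) (simp_all add: poly_op_pCons poly_op_add poly_op_smult)

lemma poly_op_1: "poly_op 1 \<alpha> = \<alpha>"
  by (simp add: one_pCons poly_op_pCons)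

lemma poly_op_diff: "poly_op (p - q) \<alpha> = poly_op p \<alpha> - poly_op q \<alpha>"
  using poly_op_add[of "p - q" q \<alpha>] by simp

lemma poly_op_sum: "poly_op (\<Sum>x\<in>A. f x) \<alpha> = (\<Sum>x\<in>A. poly_op (f x) \<alpha>)"
  by (induction A rule: infinite_finite_induct) (simp_all add: poly_op_add)

lemma poly_op_monom: "poly_op (monom c j) \<alpha> = cscale c ((B ^^ j) \<alpha>)"
  by (induction j) (simp_all add: monom_0 monom_Suc poly_op_pCons B_cscale)

lemma poly_op_selfadjoint:
  "dder n \<beta> (dder n (poly_op p \<alpha>) F) = dder n \<alpha> (dder n (poly_op p \<beta>) F)"
proof (induction p arbitrary: \<beta>)
  case (pCons c p)
  have "dder n \<beta> (dder n (B (poly_op p \<alpha>)) F) = dder n (poly_op p \<alpha>) (dder n (B \<beta>) F)"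
    by (rule selfadjoint)
  also have "\<dots> = dder n (B \<beta>) (dder n (poly_op p \<alpha>) F)" by (rule dder_commute)
  also have "\<dots> = dder n \<alpha> (dder n (B (poly_op p \<beta>)) F)" by (simp add: pCons poly_op_B)
  finally show ?case
    by (simp add: poly_op_pCons dder_add_left dder_cscale_left dder_add dder_cscale dder_commute[of n \<alpha> \<beta>])
qed simp

text \<open>The form whose derivative along each \<open>\<alpha>\<close> is \<open>p(B)\<alpha>\<circ>F\<close>: these prescribed partial derivatives
  satisfy the integrability condition because \<open>p(B)\<close> is self-adjoint, and Euler's identity
  integrates them.\<close>

definition transform :: "complex poly \<Rightarrow> cpoly" where
  "transform p = cscale (1 / of_nat d) (\<Sum>i<n. Var i * dder n (poly_op p (Var i)) F)"

lemma transform_form: "transform p \<in> forms n d"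
  unfolding transform_def
proof (intro forms_cscale forms_sum)
  fix i assume "i \<in> {..<n}"
  then have "Var i * dder n (poly_op p (Var i)) F \<in> forms n (1 + (d - 1))"
    by (intro forms_mult forms_Var dder_forms F) auto
  then show "Var i * dder n (poly_op p (Var i)) F \<in> forms n d" using d by simp
qed

lemma dder_transform:
  assumes "\<alpha> \<in> forms n 1"
  shows "dder n \<alpha> (transform p) = dder n (poly_op p \<alpha>) F"
proof -
  define Q where "Q i = dder n (poly_op p (Var i)) F" for i
  have grad: "mpderiv j (transform p) = Q j" if j: "j < n" for j
  proof -
    have sym: "mpderiv j (Q i) = mpderiv i (Q j)" if "i < n" for i
      using poly_op_selfadjoint[of "Var j" p "Var i"] that j by (simp add: Q_def dder_Var_left)
    have "mpderiv j (transform p) =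
        cscale (1 / of_nat d) (\<Sum>i<n. (if j = i then Q i else 0) + Var i * mpderiv j (Q i))"
      unfolding transform_def Q_def[symmetric] mpderiv_cscale mpderiv_sum mpderiv_mult mpderiv_Var
      by (intro arg_cong[where f = "cscale _"] sum.cong) auto
    also have "\<dots> = cscale (1 / of_nat d) (Q j + (\<Sum>i<n. Var i * mpderiv i (Q j)))"
      using j by (simp add: sum.distrib sym)
    also have "(\<Sum>i<n. Var i * mpderiv i (Q j)) = cscale (of_nat (d - 1)) (Q j)"
      unfolding Q_def by (rule euler[OF dder_forms[OF F]])
    also have "Q j + cscale (of_nat (d - 1)) (Q j) = cscale (1 + of_nat (d - 1)) (Q j)"
      by (simp add: cvec.scale_left_distrib)
    also have "(1 + of_nat (d - 1) :: complex) = of_nat d" using d by (simp add: of_nat_diff)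
    finally show ?thesis using d by simp
  qed
  have "dder n \<alpha> (transform p) = (\<Sum>i<n. cscale (lookup \<alpha> (single i 1)) (Q i))"
    unfolding dder_def[of n \<alpha>] by (intro sum.cong) (auto simp: grad)
  also have "\<dots> = dder n (poly_op p (\<Sum>i<n. cscale (lookup \<alpha> (single i 1)) (Var i))) F"
    by (simp add: Q_def poly_op_sum_right poly_op_cscale dder_sum_left dder_cscale_left)
  finally show ?thesis by (simp flip: linear_form_expand[OF assms, simplified])
qed

text \<open>The kernel of \<open>p \<mapsto> transform p\<close>.  It is an ideal, since \<open>(p q)(B)\<alpha> = p(B)(q(B)\<alpha>)\<close> and
  \<open>q(B)\<alpha>\<close> lies again in \<open>V\<^sup>*\<close>.\<close>

definition annihilator :: "complex poly set" where
  "annihilator = {p. \<forall>\<alpha>\<in>forms n 1. dder n (poly_op p \<alpha>) F = 0}"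

lemma annihilator_add: "p \<in> annihilator \<Longrightarrow> q \<in> annihilator \<Longrightarrow> p + q \<in> annihilator"
  by (simp add: annihilator_def poly_op_add dder_add_left)

lemma annihilator_mult: "p \<in> annihilator \<Longrightarrow> q * p \<in> annihilator"
  by (simp add: annihilator_def mult.commute[of q] poly_op_mult poly_op_form del: One_nat_def)

lemma transform_neq_0: "p \<notin> annihilator \<Longrightarrow> transform p \<noteq> 0"
  using dder_transform[of _ p] by (auto simp: annihilator_def simp del: One_nat_def)

text \<open>For each basis vector of \<open>V\<^sup>*\<close> its \<open>n + 1\<close> images under \<open>B\<^sup>0, ..., B\<^sup>n\<close> are linearly dependent, which gives
  a polynomial in \<open>B\<close> that kills it; the product of these polynomials kills \<open>V\<^sup>*\<close>.\<close>

lemma annihilator_nonzero: "\<exists>p\<in>annihilator. p \<noteq> 0"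
proof -
  have "\<exists>p. p \<noteq> 0 \<and> poly_op p (Var i) = 0" if i: "i < n" for i
  proof -
    define f where "f j = (B ^^ j) (Var i)" for j
    have f: "f j \<in> forms n 1" for j
      by (induction j) (use forms_Var[OF i] B_form in \<open>auto simp: f_def simp del: One_nat_def\<close>)
    have "\<exists>c. (\<Sum>j<Suc n. cscale (c j) (f j)) = 0 \<and> (\<exists>j<Suc n. c j \<noteq> 0)"
    proof (rule ccontr)
      assume "\<nexists>c. (\<Sum>j<Suc n. cscale (c j) (f j)) = 0 \<and> (\<exists>j<Suc n. c j \<noteq> 0)"
      then have *: "\<And>c. (\<Sum>j<Suc n. cscale (c j) (f j)) = 0 \<Longrightarrow> \<forall>j<Suc n. c j = 0" by blast
      have "f ` {..<Suc n} \<subseteq> cvec.span (Var ` {..<n})"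
        unfolding Var_basis(3) using f by blast
      from cvec.independent_span_bound[OF _ independent_image_lessThanI(2)[OF *] this]
      have "card (f ` {..<Suc n}) \<le> card (Var ` {..<n})" by simp
      then show False
        using card_image[OF independent_image_lessThanI(1)[OF *]] card_image[OF Var_basis(1), of n] by simp
    qed
    then obtain c j where c: "(\<Sum>j<Suc n. cscale (c j) (f j)) = 0" and j: "j < Suc n" "c j \<noteq> 0" by blast
    define p where "p = (\<Sum>j<Suc n. monom (c j) j)"
    have "coeff p j = c j"
      unfolding p_def coeff_sum using j(1) by (simp only: coeff_monom) (simp del: sum.lessThan_Suc)
    then have "p \<noteq> 0" using j(2) by auto
    moreover have "poly_op p (Var i) = 0"
      using c by (simp add: p_def poly_op_sum poly_op_monom f_def del: sum.lessThan_Suc)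
    ultimately show ?thesis by blast
  qed
  then obtain p where p: "\<And>i. i < n \<Longrightarrow> p i \<noteq> 0" "\<And>i. i < n \<Longrightarrow> poly_op (p i) (Var i) = 0" by metis
  let ?m = "\<Prod>i<n. p i"
  have "poly_op ?m (Var i) = 0" if "i < n" for i
  proof -
    have "?m = (\<Prod>j\<in>{..<n} - {i}. p j) * p i"
      using that by (subst prod.remove[of _ i]) (auto simp: mult.commute)
    then show ?thesis using p(2)[OF that] by (simp add: poly_op_mult)
  qed
  then have "poly_op ?m \<alpha> = 0" if "\<alpha> \<in> forms n 1" for \<alpha>
    by (subst linear_form_expand[OF that]) (simp add: poly_op_sum_right poly_op_cscale)
  then have "?m \<in> annihilator" by (simp add: annihilator_def del: One_nat_def)
  moreover have "?m \<noteq> 0" using p(1) by simp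
  ultimately show ?thesis by blast
qed

text \<open>\<open>F\<close> is the sum of its transforms by \<open>u\<close> and \<open>1 - u\<close>.  As \<open>u (1 - u)\<close> acts as zero, \<open>u(B)\<alpha>\<close> annihilates the
  transform by \<open>1 - u\<close> and \<open>\<alpha> - u(B)\<alpha>\<close> annihilates the transform by \<open>u\<close>.\<close>

lemma idempotent_splits:
  assumes u: "u \<notin> annihilator" "1 - u \<notin> annihilator" "u * (1 - u) \<in> annihilator"
  shows "is_direct_sum n d F"
proof -
  have "transform u + transform (1 - u) - F = 0"
  proof (rule dder_eq_0[OF _ d])
    show "transform u + transform (1 - u) - F \<in> forms n d"
      by (intro forms_diff forms_add transform_form F)
    show "dder n \<alpha> (transform u + transform (1 - u) - F) = 0" if "\<alpha> \<in> forms n 1" for \<alpha>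
      using that by (simp add: dder_diff dder_add dder_transform poly_op_diff poly_op_1 dder_diff_left
          del: One_nat_def)
  qed
  moreover have "is_direct_sum n d (transform u + transform (1 - u))"
  proof (rule direct_sum_of_complementary_annihilators)
    fix \<alpha> assume \<alpha>: "\<alpha> \<in> forms n 1"
    have "dder n (poly_op u \<alpha>) (transform (1 - u)) = dder n (poly_op ((1 - u) * u) \<alpha>) F"
      using \<alpha> by (simp add: dder_transform poly_op_form poly_op_mult del: One_nat_def)
    moreover have "dder n (\<alpha> - poly_op u \<alpha>) (transform u) = dder n (poly_op (u * (1 - u)) \<alpha>) F"
      using \<alpha> dder_transform[OF poly_op_form[OF \<alpha>, of "1 - u"], of u]
      by (simp add: poly_op_mult poly_op_diff poly_op_1)
    ultimately show "\<exists>\<beta>\<in>forms n 1. dder n \<beta> (transform (1 - u)) = 0 \<and> dder n (\<alpha> - \<beta>) (transform u) = 0"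
      using u(3) \<alpha> poly_op_form[OF \<alpha>, of u] by (auto simp: annihilator_def mult.commute simp del: One_nat_def)
  qed (use u transform_form transform_neq_0 in auto)
  ultimately show ?thesis by simp
qed

end

section \<open>The dichotomy\<close>

text \<open>Expressing the partial derivatives of the companion form \<open>G\<close> through those of \<open>F\<close> defines \<open>B\<close>, with
  \<open>B\<alpha>\<circ>F = \<alpha>\<circ>G\<close>; it is self-adjoint because \<open>\<beta>\<alpha>\<circ>G\<close> is symmetric in \<open>\<alpha>\<close> and \<open>\<beta>\<close>.  The annihilator
  contains no nonzero polynomial of degree at most one, since \<open>G\<close> is not a multiple of \<open>F\<close>.\<close>

lemma equipotent_dichotomy:
  assumes F: "F \<in> forms n d" "F \<noteq> 0" and gen: "has_equipotent_apolar_generator n d F"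
  obtains (split) "is_direct_sum n d F"
  | (nilpotent) G where "d \<ge> 1" and "G \<in> forms n d" and "G \<noteq> 0"
    and "\<And>\<alpha>. \<alpha> \<in> forms n 1 \<Longrightarrow> \<exists>\<beta>\<in>forms n 1. dder n \<alpha> G = dder n \<beta> F \<and> dder n \<beta> G = 0"
proof -
  obtain G where d: "d \<ge> 1" and G: "G \<in> forms n d" and notmult: "\<And>c. G \<noteq> cscale c F"
    and dep: "\<And>\<alpha>. \<alpha> \<in> forms n 1 \<Longrightarrow> \<exists>\<beta>\<in>forms n 1. dder n \<alpha> G = dder n \<beta> F"
    by (rule equipotent_companion[OF F gen]) blast
  have "\<exists>\<beta>\<in>forms n 1. mpderiv i G = dder n \<beta> F" if "i < n" for i
    using dep[OF forms_Var[OF that]] that by (simp add: dder_Var_left del: One_nat_def)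
  then obtain b where b: "\<And>i. i < n \<Longrightarrow> b i \<in> forms n 1" "\<And>i. i < n \<Longrightarrow> mpderiv i G = dder n (b i) F"
    by metis
  define B where "B \<alpha> = (\<Sum>i<n. cscale (lookup \<alpha> (single i 1)) (b i))" for \<alpha> :: cpoly
  have BF: "dder n (B \<alpha>) F = dder n \<alpha> G" for \<alpha> :: cpoly
    by (simp add: B_def dder_sum_left dder_cscale_left dder_def[of n \<alpha> G] b(2))
  interpret selfadjoint_operator n d F B
  proof
    show "B \<alpha> \<in> forms n 1" for \<alpha> unfolding B_def by (intro forms_sum forms_cscale b(1)) simp
    show "B (\<alpha> + \<beta>) = B \<alpha> + B \<beta>" for \<alpha> \<beta>
      by (simp add: B_def lookup_add cvec.scale_left_distrib sum.distrib)
    show "B (cscale c \<alpha>) = cscale c (B \<alpha>)" for c \<alpha>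
      by (simp add: B_def cvec.scale_sum_right)
    show "dder n \<beta> (dder n (B \<alpha>) F) = dder n \<alpha> (dder n (B \<beta>) F)" for \<alpha> \<beta>
      unfolding BF by (rule dder_commute)
  qed (use F d in auto)
  have linear: "p = 0" if p: "p \<in> annihilator" "degree p \<le> 1" for p
  proof -
    obtain c0 p' where p': "p = pCons c0 p'" by (cases p)
    then have "degree p' = 0" using p(2) by (cases "p' = 0") auto
    then obtain c1 where "p' = [:c1:]" by (rule degree_eq_zeroE)
    with p' have p01: "p = [:c0, c1:]" by simp
    have "cscale c0 F + cscale c1 G = 0"
    proof (rule dder_eq_0[OF _ d])
      show "cscale c0 F + cscale c1 G \<in> forms n d" by (intro forms_add forms_cscale F G)
      fix \<alpha> assume "\<alpha> \<in> forms n 1"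
      then have "dder n (poly_op p \<alpha>) F = 0" using p(1) by (simp add: annihilator_def)
      then show "dder n \<alpha> (cscale c0 F + cscale c1 G) = 0"
        by (simp add: p01 poly_op_pCons dder_add dder_cscale dder_add_left dder_cscale_left BF B_cscale)
    qed
    then have eq: "cscale c1 G = cscale (- c0) F" by (simp add: add_eq_0_iff)
    have "c1 = 0"
    proof (rule ccontr)
      assume "c1 \<noteq> 0"
      then have "G = cscale (1 / c1) (cscale c1 G)" by simp
      also have "\<dots> = cscale (1 / c1 * (- c0)) F" unfolding eq by simp
      finally show False using notmult by blast
    qed
    then show "p = 0" using eq assms(2) by (simp add: p01)
  qed
  obtain p\<^sub>0 where "p\<^sub>0 \<in> annihilator" "p\<^sub>0 \<noteq> 0" using annihilator_nonzero by blast
  from annihilator_add annihilator_mult this linear show thesis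
  proof (rule poly_ideal_idempotent_or_nilpotent)
    fix p assume nilpotent: "p \<notin> annihilator" "p * p \<in> annihilator"
    show thesis
    proof (rule that(2)[OF d transform_form transform_neq_0[OF nilpotent(1)]])
      fix \<alpha> assume \<alpha>: "\<alpha> \<in> forms n 1"
      have "dder n (poly_op p \<alpha>) (transform p) = dder n (poly_op (p * p) \<alpha>) F"
        using \<alpha> by (simp add: dder_transform poly_op_form poly_op_mult del: One_nat_def)
      then have "dder n (poly_op p \<alpha>) (transform p) = 0"
        using nilpotent(2) \<alpha> by (simp add: annihilator_def)
      then show "\<exists>\<beta>\<in>forms n 1. dder n \<alpha> (transform p) = dder n \<beta> F \<and> dder n \<beta> (transform p) = 0"
        using poly_op_form[OF \<alpha>, of p] dder_transform[OF \<alpha>, of p] by blast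
    qed
  next
    fix u assume "u \<notin> annihilator" "1 - u \<notin> annihilator" "u * (1 - u) \<in> annihilator"
    then show thesis by (intro that(1) idempotent_splits)
  qed
qed

theorem theorem4p5:
  fixes n d :: nat and F :: cpoly
  assumes "F \<in> forms n d" and "F \<noteq> 0"
    and "has_equipotent_apolar_generator n d F"
  shows "is_limit_of_direct_sums n d F \<and>
    (is_direct_sum n d F \<or>
     (\<exists>k x y z. 1 \<le> k \<and> 2 * k \<le> n \<and>
        is_basis_of (map x [0..<k] @ map y [0..<k] @ map z [0..<n - 2 * k]) (forms n 1) \<and>
        (\<exists>G h. G \<in> Sym d (cvec.span (y ` {..<k} \<union> z ` {..<n - 2 * k})) \<and>
               h \<in> forms k d \<and>
               F = (\<Sum>i<k. x i * subst y (mpderiv i h)) + G)))"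
  using assms
proof (cases rule: equipotent_dichotomy)
  case split
  then have "lookup F \<in> closure (lookup ` {P. is_direct_sum n d P})"
    by (intro subsetD[OF closure_subset]) auto
  with split assms(1) show ?thesis by (simp add: is_limit_of_direct_sums_def)
next
  case (nilpotent G)
  obtain k e l g q where k: "1 \<le> k" "2 * k \<le> n" and "dual_bases n e l"
    and g: "g \<in> forms k d" "G = subst l g" and q: "q \<in> forms n d"
    "\<And>m i. m \<in> keys q \<Longrightarrow> i \<in> keys m \<Longrightarrow> i < k \<or> 2 * k \<le> i"
    and F: "F = (\<Sum>i<k. l (k + i) * subst l (mpderiv i g)) + subst l q"
    by (rule nilpotent_normal_form[OF assms(1) nilpotent(2,3,1,4)]) blast+
  interpret dual_bases n e l by fact
  have "is_limit_of_direct_sums n d F"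
    by (rule limit_of_direct_sums[OF k(2) g(1) _ q assms(1) F]) (use g(2) nilpotent(3) in auto)
  moreover have "\<exists>k x y z. 1 \<le> k \<and> 2 * k \<le> n \<and>
        is_basis_of (map x [0..<k] @ map y [0..<k] @ map z [0..<n - 2 * k]) (forms n 1) \<and>
        (\<exists>G h. G \<in> Sym d (cvec.span (y ` {..<k} \<union> z ` {..<n - 2 * k})) \<and>
               h \<in> forms k d \<and>
               F = (\<Sum>i<k. x i * subst y (mpderiv i h)) + G)"
  proof (intro exI conjI)
    let ?x = "\<lambda>i. l (k + i)" and ?z = "\<lambda>i. l (2 * k + i)"
    let ?bs = "map ?x [0..<k] @ map l [0..<k] @ map ?z [0..<n - 2 * k]"
    have set: "set ?bs = l ` {..<n}"
    proof
      show "set ?bs \<subseteq> l ` {..<n}" using k(2) by auto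
      show "l ` {..<n} \<subseteq> set ?bs"
      proof (rule image_subsetI)
        fix i assume i: "i \<in> {..<n}"
        consider "i < k" | "i = k + (i - k)" "i - k < k" | "i = 2 * k + (i - 2 * k)" "i - 2 * k < n - 2 * k"
          using i by force
        then show "l i \<in> set ?bs"
        proof cases
          case 2
          then have "l i \<in> ?x ` {0..<k}" by (intro image_eqI[of _ _ "i - k"]) auto
          then show ?thesis by simp
        next
          case 3
          then have "l i \<in> ?z ` {0..<n - 2 * k}" by (intro image_eqI[of _ _ "i - 2 * k"]) auto
          then show ?thesis by simp
        qed simp
      qed
    qed
    have "length ?bs = n" using k(2) by simp
    moreover have "card (l ` {..<n}) = n" using card_image[OF basis(1)] by simp
    ultimately have "distinct ?bs" by (intro card_distinct) (simp only: set)
    then show "is_basis_of ?bs (forms n 1)"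
      unfolding is_basis_of_def set using basis(2,3) by blast
    show "subst l q \<in> Sym d (cvec.span (l ` {..<k} \<union> ?z ` {..<n - 2 * k}))"
    proof (rule subst_Sym[OF q(1)])
      fix m i assume m: "m \<in> keys q" "i \<in> keys m"
      then have "i < n" using polysD[OF forms_polys[OF q(1)]] by blast
      have "l i \<in> l ` {..<k} \<union> ?z ` {..<n - 2 * k}"
      proof (cases "i < k")
        case False
        then have "2 * k \<le> i" using q(2)[OF m] by simp
        then show ?thesis using \<open>i < n\<close> by (intro UnI2 image_eqI[of _ _ "i - 2 * k"]) auto
      qed simp
      then show "l i \<in> cvec.span (l ` {..<k} \<union> ?z ` {..<n - 2 * k})" by (rule cvec.span_base)
    qed
  qed (use k g(1) F in auto)
  ultimately show ?thesis by blast
qed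

end
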